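(* For all sufficiently large $x$, $$\sum_{n\le x}\mu(n)\omega(n)\left\{\frac{x}{n}\right\}=O\!\left(\frac{x\sqrt{\log\log x}}{\sqrt{\log x}}\right),$$ where $\{w\}=w-\lfloor w\rfloor$ denotes the fractional part of $w$.
   Context: $\mu$ is the Möbius function and $\omega(n)$ is the number of distinct prime factors of $n$ (with $\omega(1)=0$). *)

theory Defs
  imports
    Complex_Main
    "HOL-Computational_Algebra.Primes"
    "HOL-Computational_Algebra.Squarefree"
    "HOL-Library.Landau_Symbols"
begin

definition prime_omega :: "nat \<Rightarrow> nat" where
  "prime_omega n = card (prime_factors n)"

text \<open>At the irrelevant argument 0 the value is 0, since 0 is not squarefree.\<close>

definition moebius_mu :: "nat \<Rightarrow> int" where
  "moebius_mu n = (if squarefree n then (-1) ^ card (prime_factors n) else 0)"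

end

theory Submission
  imports
    Defs
    "HOL-Complex_Analysis.Complex_Analysis"
    "HOL-Number_Theory.Prime_Powers"
    "HOL-Real_Asymp.Real_Asymp"
    "HOL-Library.Discrete_Functions"
begin

text \<open>
  Write the fractional part of \<open>x/n\<close> as \<open>x/n - \<lfloor>x/n\<rfloor>\<close>. Since the divisor sum of
  \<open>\<mu> \<omega>\<close> at \<open>m\<close> is \<open>-1\<close> if \<open>m\<close> is a prime power and 0 otherwise, the part with
  \<open>\<lfloor>x/n\<rfloor>\<close> contributes the number of prime powers up to \<open>x\<close>, which is \<open>O(x / ln x)\<close> by
  Chebyshev's argument. By Moebius inversion the sum of \<open>\<mu>(n) \<omega>(n) / n\<close> over \<open>n \<le> x\<close> equals
  minus the sum of \<open>m(x/q) / q\<close> over prime powers \<open>q \<le> x\<close>, where \<open>m(y)\<close> is the sum of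
  \<open>\<mu>(n) / n\<close> over \<open>n \<le> y\<close>. Given \<open>m(y) = O(1 / ln y)\<close>, splitting the \<open>q\<close> dyadically
  bounds this sum by \<open>O(ln (ln x) / ln x)\<close>, which is more than enough.

  The estimate for \<open>m\<close> has the depth of the prime number theorem with an error term. The 3-4-1
  inequality and a bound of order \<open>\<bar>t\<bar> powr (1/10)\<close> for \<open>\<zeta>\<close> near the line \<open>Re s = 1\<close> give a
  zero-free region of width \<open>\<kappa> / sqrt \<bar>t\<bar>\<close> in which \<open>1 / \<zeta>\<close> is
  \<open>O(sqrt \<bar>t\<bar>)\<close>. Newman's contour method applied to \<open>1 / \<zeta>(1 + z)\<close>, which vanishes at
  0, with a contour of height \<open>ln N\<close> inside this region then shows \<open>m(N) = O(1 / ln N)\<close>.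
\<close>

section \<open>Newman's contour method\<close>

lemma norm_of_nat_powr: "n > 0 \<Longrightarrow> norm ((of_nat n :: complex) powr z) = real n powr Re z"
  by (simp add: norm_powr_real_powr)

lemma powr_diff_mvt:
  fixes u a :: real
  assumes "u > 0"
  obtains \<xi> where "u < \<xi>" "\<xi> < u + 1" "(u + 1) powr a - u powr a = a * \<xi> powr (a - 1)"
proof -
  have "\<exists>z>u. z < u + 1 \<and> (u + 1) powr a - u powr a = (u + 1 - u) * (a * z powr (a - 1))"
    using assms
    by (intro MVT2[of u "u + 1" "\<lambda>t. t powr a" "\<lambda>t. a * t powr (a - 1)"] has_real_derivative_powr) auto
  with that show thesis by auto
qed

text \<open>The mean value theorem bounds each term by the decrease of
  \<open>t powr (-x) / x\<close> over the unit interval to its left, so the series is dominated by a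
  telescoping one.\<close>

lemma powr_tail:
  fixes x :: real and N :: nat
  assumes x: "x > 0" and N: "N > 0"
  shows "summable (\<lambda>k. real (N + k + 1) powr (-1 - x))" (is ?A)
    and "(\<Sum>k. real (N + k + 1) powr (-1 - x)) \<le> real N powr (-x) / x" (is ?B)
proof -
  have "((\<lambda>k. real (N + k) powr (-x)) \<longlonglongrightarrow> 0)"
    using x by real_asymp
  then have "(\<lambda>k. real (N + k) powr (-x) - real (N + Suc k) powr (-x)) sums (real (N + 0) powr (-x) - 0)"
    by (rule telescope_sums')
  from sums_divide[OF this, of x]
  have s: "(\<lambda>k. (real (N + k) powr (-x) - real (N + Suc k) powr (-x)) / x) sums (real N powr (-x) / x)"
    by simp
  have le: "real (N + k + 1) powr (-1 - x) \<le> (real (N + k) powr (-x) - real (N + Suc k) powr (-x)) / x" for k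
  proof -
    have pos: "0 < real (N + k)" using N by simp
    obtain \<xi> where \<xi>: "real (N + k) < \<xi>" "\<xi> < real (N + k) + 1"
      "(real (N + k) + 1) powr (-x) - real (N + k) powr (-x) = (-x) * \<xi> powr (-x - 1)"
      using powr_diff_mvt[OF pos] by metis
    have "(real (N + k) powr (-x) - real (N + Suc k) powr (-x)) / x = \<xi> powr (-1 - x)"
    proof -
      have "real (N + Suc k) powr (-x) - real (N + k) powr (-x) = - (x * \<xi> powr (-1 - x))"
      proof -
        have "-x - 1 = -1 - x" by simp
        with \<xi>(3) show ?thesis by (simp only:) (simp add: add_ac)
      qed
      then show ?thesis using x by (simp add: field_simps)
    qed
    also have "\<dots> \<ge> real (N + k + 1) powr (-1 - x)"
      using \<xi> pos x by (intro powr_mono2') auto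
    finally show ?thesis .
  qed
  show ?A by (rule summable_comparison_test'[OF sums_summable[OF s], of 0]) (use le in auto)
  then show ?B using suminf_le[OF le _ sums_summable[OF s]] sums_unique[OF s] by simp
qed

text \<open>Comparison with a telescoping sum of \<open>t powr y / y\<close>. For
  \<open>y \<le> 1\<close> each summand lies below the integral over the preceding unit interval.
  For \<open>y > 1\<close> it lies below the integral over the following one, so the last summand is
  split off, which accounts for \<open>1 / real N\<close>.\<close>

lemma powr_partial_sum:
  fixes y :: real and N :: nat
  assumes y: "y > 0" and N: "N > 0"
  shows "(\<Sum>n<N. real (Suc n) powr (y - 1)) \<le> real N powr y * (1 / real N + 1 / y)"
proof (cases "y \<le> 1")
  case True
  have "(\<Sum>n<M. real (Suc n) powr (y - 1)) \<le> real M powr y / y" for M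
  proof (induction M)
    case (Suc M)
    have "real (Suc M) powr (y - 1) \<le> real (Suc M) powr y / y - real M powr y / y"
    proof (cases "M = 0")
      case True
      then show ?thesis using y \<open>y \<le> 1\<close> by (simp add: field_simps)
    next
      case False
      obtain \<xi> where \<xi>: "real M < \<xi>" "\<xi> < real M + 1"
        "(real M + 1) powr y - real M powr y = y * \<xi> powr (y - 1)"
        using powr_diff_mvt[of "real M"] False by (metis of_nat_0_less_iff neq0_conv)
      have "real (Suc M) powr (y - 1) \<le> \<xi> powr (y - 1)"
        using \<xi> \<open>y \<le> 1\<close> False by (intro powr_mono2') auto
      also have "\<dots> = real (Suc M) powr y / y - real M powr y / y"
        using \<xi>(3) y by (simp add: field_simps)
      finally show ?thesis .
    qed
    with Suc show ?case by simp
  qed simp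
  moreover have "real N powr y / y \<le> real N powr y * (1 / real N + 1 / y)"
    by (simp add: algebra_simps)
  ultimately show ?thesis by (meson order_trans)
next
  case False
  have "(\<Sum>n<M. real (Suc n) powr (y - 1)) \<le> real (Suc M) powr y / y" for M
  proof (induction M)
    case 0
    then show ?case using y by simp
  next
    case (Suc M)
    obtain \<xi> where \<xi>: "real (Suc M) < \<xi>" "\<xi> < real (Suc M) + 1"
      "(real (Suc M) + 1) powr y - real (Suc M) powr y = y * \<xi> powr (y - 1)"
      using powr_diff_mvt[of "real (Suc M)"] by (metis of_nat_0_less_iff zero_less_Suc)
    have "real (Suc M) powr (y - 1) \<le> \<xi> powr (y - 1)"
      using \<xi> False by (intro powr_mono2) auto
    also have "\<dots> = real (Suc (Suc M)) powr y / y - real (Suc M) powr y / y"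
      using \<xi>(3) y by (simp add: field_simps)
    finally show ?case using Suc by simp
  qed
  from this[of "N - 1"] N
  have "(\<Sum>n<N - 1. real (Suc n) powr (y - 1)) \<le> real N powr y / y" by simp
  moreover have "(\<Sum>n<N. real (Suc n) powr (y - 1)) = (\<Sum>n<N - 1. real (Suc n) powr (y - 1)) + real N powr (y - 1)"
    using N by (cases N) auto
  moreover have "real N powr (y - 1) = real N powr y / real N" using N by (simp add: powr_diff)
  ultimately show ?thesis by (simp add: algebra_simps)
qed

text \<open>The boundary of a rectangle around 0 is cut at the imaginary axis because two rectangles
  share the right half: one of left width \<open>d\<close> for the limit function and one of left
  width \<open>R\<close> for the partial sum.\<close>

definition newman_right :: "real \<Rightarrow> (complex \<Rightarrow> complex) \<Rightarrow> complex" where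
  "newman_right R g = contour_integral (linepath (Complex 0 (-R)) (Complex R (-R))) g
     + contour_integral (linepath (Complex R (-R)) (Complex R R)) g
     + contour_integral (linepath (Complex R R) (Complex 0 R)) g"

definition newman_left :: "real \<Rightarrow> real \<Rightarrow> (complex \<Rightarrow> complex) \<Rightarrow> complex" where
  "newman_left R d g = contour_integral (linepath (Complex 0 R) (Complex (-d) R)) g
     + contour_integral (linepath (Complex (-d) R) (Complex (-d) (-R))) g
     + contour_integral (linepath (Complex (-d) (-R)) (Complex 0 (-R))) g"

lemma closed_segment_horizontal:
  assumes "x1 \<le> x2"
  shows "closed_segment (Complex x1 y) (Complex x2 y) = {z. Im z = y \<and> Re z \<in> {x1..x2}}"
proof -
  have "closed_segment (Complex x1 y) (Complex x2 y) = {z. Im z = y \<and> Re z \<in> closed_segment x1 x2}"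
    by (subst closed_segment_same_Im) auto
  then show ?thesis using assms by (simp add: closed_segment_eq_real_ivl)
qed

lemma closed_segment_vertical:
  assumes "y1 \<le> y2"
  shows "closed_segment (Complex x y1) (Complex x y2) = {z. Re z = x \<and> Im z \<in> {y1..y2}}"
proof -
  have "closed_segment (Complex x y1) (Complex x y2) = {z. Re z = x \<and> Im z \<in> closed_segment y1 y2}"
    by (subst closed_segment_same_Re) auto
  then show ?thesis using assms by (simp add: closed_segment_eq_real_ivl)
qed

lemma contour_integral_rectpath_split:
  assumes R: "R > 0" and d: "d > 0"
    and g: "continuous_on (path_image (rectpath (Complex (-d) (-R)) (Complex R R))) g"
  shows "contour_integral (rectpath (Complex (-d) (-R)) (Complex R R)) g
           = newman_right R g + newman_left R d g"
proof -
  let ?a = "Complex (-d) (-R)" and ?b = "Complex R (-R)" and ?c = "Complex R R" and ?e = "Complex (-d) R"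
  have pi: "path_image (rectpath ?a ?c) = closed_segment ?a ?b \<union> closed_segment ?b ?c
      \<union> closed_segment ?c ?e \<union> closed_segment ?e ?a"
    by (auto simp: rectpath_def Let_def path_image_join)
  have cs: "continuous_on (closed_segment ?a ?b) g" "continuous_on (closed_segment ?b ?c) g"
     "continuous_on (closed_segment ?c ?e) g" "continuous_on (closed_segment ?e ?a) g"
    by (rule continuous_on_subset[OF g]; simp add: pi; blast)+
  note ci = cs[THEN contour_integrable_continuous_linepath]
  have 1: "contour_integral (linepath ?a ?b) g = contour_integral (linepath ?a (Complex 0 (-R))) g
      + contour_integral (linepath (Complex 0 (-R)) ?b) g"
    by (rule contour_integral_split_linepath[OF cs(1)]) (use R d in \<open>simp add: closed_segment_horizontal\<close>)
  have 2: "contour_integral (linepath ?c ?e) g = contour_integral (linepath ?c (Complex 0 R)) g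
      + contour_integral (linepath (Complex 0 R) ?e) g"
    by (rule contour_integral_split_linepath[OF cs(3)])
       (use R d in \<open>simp add: closed_segment_commute[of ?c] closed_segment_horizontal\<close>)
  have "contour_integral (rectpath ?a ?c) g = contour_integral (linepath ?a ?b) g + contour_integral (linepath ?b ?c) g
     + contour_integral (linepath ?c ?e) g + contour_integral (linepath ?e ?a) g"
    using ci by (simp add: rectpath_def Let_def contour_integrable_joinI valid_path_join)
  then show ?thesis unfolding 1 2 newman_right_def newman_left_def by simp
qed

lemma newman_right_bound:
  assumes R: "R > 0" and B: "B \<ge> 0"
    and g: "continuous_on {z. Re z \<in> {0..R} \<and> \<bar>Im z\<bar> = R \<or> Re z = R \<and> Im z \<in> {-R..R}} g"
    and le: "\<And>z. Re z \<in> {0..R} \<and> \<bar>Im z\<bar> = R \<or> Re z = R \<and> Im z \<in> {-R..R} \<Longrightarrow> norm (g z) \<le> B"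
  shows "norm (newman_right R g) \<le> 4 * R * B"
proof -
  have 1: "norm (contour_integral (linepath (Complex 0 (-R)) (Complex R (-R))) g)
      \<le> B * norm (Complex R (-R) - Complex 0 (-R))"
    by (intro contour_integral_bound_linepath contour_integrable_continuous_linepath continuous_on_subset[OF g] B le)
       (use R in \<open>auto simp: closed_segment_horizontal\<close>)
  have 2: "norm (contour_integral (linepath (Complex R (-R)) (Complex R R)) g)
      \<le> B * norm (Complex R R - Complex R (-R))"
    by (intro contour_integral_bound_linepath contour_integrable_continuous_linepath continuous_on_subset[OF g] B le)
       (use R in \<open>auto simp: closed_segment_vertical\<close>)
  have 3: "norm (contour_integral (linepath (Complex R R) (Complex 0 R)) g)
      \<le> B * norm (Complex 0 R - Complex R R)"
    by (intro contour_integral_bound_linepath contour_integrable_continuous_linepath continuous_on_subset[OF g] B le)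
       (use R in \<open>auto simp: closed_segment_commute[of "Complex R R"] closed_segment_horizontal\<close>)
  have n: "norm (Complex R (-R) - Complex 0 (-R)) = R" "norm (Complex R R - Complex R (-R)) = 2 * R"
    "norm (Complex 0 R - Complex R R) = R"
    using R by (simp_all add: cmod_def real_sqrt_mult)
  show ?thesis
    unfolding newman_right_def
    by (rule order_trans[OF norm_triangle_ineq] order_trans[OF add_mono[OF norm_triangle_ineq order_refl]])+
       (use 1 2 3 n in \<open>simp add: algebra_simps\<close>)
qed

lemma newman_left_bound:
  assumes R: "R > 0" and d: "d > 0" and B: "B \<ge> 0" "B' \<ge> 0"
    and g: "continuous_on {z. Re z \<in> {-d..0} \<and> \<bar>Im z\<bar> = R \<or> Re z = -d \<and> Im z \<in> {-R..R}} g"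
    and le: "\<And>z. Re z \<in> {-d..0} \<Longrightarrow> \<bar>Im z\<bar> = R \<Longrightarrow> norm (g z) \<le> B"
    and le': "\<And>z. Re z = -d \<Longrightarrow> Im z \<in> {-R..R} \<Longrightarrow> norm (g z) \<le> B'"
  shows "norm (newman_left R d g) \<le> 2 * d * B + 2 * R * B'"
proof -
  have 1: "norm (contour_integral (linepath (Complex 0 R) (Complex (-d) R)) g)
      \<le> B * norm (Complex (-d) R - Complex 0 R)"
    by (intro contour_integral_bound_linepath contour_integrable_continuous_linepath continuous_on_subset[OF g] B le)
       (use R d in \<open>auto simp: closed_segment_commute[of "Complex 0 R"] closed_segment_horizontal\<close>)
  have 2: "norm (contour_integral (linepath (Complex (-d) R) (Complex (-d) (-R))) g)
      \<le> B' * norm (Complex (-d) (-R) - Complex (-d) R)"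
    by (intro contour_integral_bound_linepath contour_integrable_continuous_linepath continuous_on_subset[OF g] B le')
       (use R d in \<open>auto simp: closed_segment_commute[of "Complex (-d) R"] closed_segment_vertical\<close>)
  have 3: "norm (contour_integral (linepath (Complex (-d) (-R)) (Complex 0 (-R))) g)
      \<le> B * norm (Complex 0 (-R) - Complex (-d) (-R))"
    by (intro contour_integral_bound_linepath contour_integrable_continuous_linepath continuous_on_subset[OF g] B le)
       (use R d in \<open>auto simp: closed_segment_horizontal\<close>)
  have n: "norm (Complex (-d) R - Complex 0 R) = d" "norm (Complex (-d) (-R) - Complex (-d) R) = 2 * R"
    "norm (Complex 0 (-R) - Complex (-d) (-R)) = d"
    using R d by (simp_all add: cmod_def real_sqrt_mult)
  show ?thesis
    unfolding newman_left_def
    by (rule order_trans[OF norm_triangle_ineq] order_trans[OF add_mono[OF norm_triangle_ineq order_refl]])+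
       (use 1 2 3 n in \<open>simp add: algebra_simps\<close>)
qed

text \<open>On a horizontal side \<open>z\<^sup>2 + R\<^sup>2\<close> has the factor
  \<open>Re z\<close>; on a vertical side \<open>\<bar>Re z\<bar> = R\<close>, so the trivial bound
  already has this shape. The factor \<open>\<bar>Re z\<bar>\<close> cancels the
  \<open>1 / \<bar>Re z\<bar>\<close> in the bounds for tail and partial sum.\<close>

lemma norm_one_plus_div_le:
  fixes z :: complex
  assumes R: "R > 0" and z: "\<bar>Re z\<bar> \<le> R" "\<bar>Im z\<bar> \<le> R" "\<bar>Re z\<bar> = R \<or> \<bar>Im z\<bar> = R"
  shows "norm ((1 + z\<^sup>2 / of_real R ^ 2) / z) \<le> 3 * \<bar>Re z\<bar> / R\<^sup>2"
proof -
  have zR: "norm z \<ge> R"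
    using z(3) abs_Re_le_cmod[of z] abs_Im_le_cmod[of z] by auto
  have *: "norm (z\<^sup>2 + of_real R ^ 2) \<le> 3 * R * \<bar>Re z\<bar>"
    using z(3)
  proof
    assume re: "\<bar>Re z\<bar> = R"
    have "norm (z\<^sup>2 + of_real R ^ 2) \<le> (norm z)\<^sup>2 + R\<^sup>2"
      using R by (intro order_trans[OF norm_triangle_ineq]) (simp add: norm_power)
    also have "(norm z)\<^sup>2 = (Re z)\<^sup>2 + (Im z)\<^sup>2" by (simp add: cmod_power2)
    also have "(Im z)\<^sup>2 \<le> R\<^sup>2" using z(2) R by (metis abs_le_square_iff abs_of_pos)
    also have "(Re z)\<^sup>2 = R\<^sup>2" using re by (metis power2_abs)
    finally show ?thesis using re by (simp add: power2_eq_square)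
  next
    assume "\<bar>Im z\<bar> = R"
    then have im: "(Im z)\<^sup>2 = R\<^sup>2" by (metis power2_abs)
    have "z\<^sup>2 + of_real R ^ 2 = of_real (Re z) * Complex (Re z) (2 * Im z)"
      using im by (simp add: complex_eq_iff power2_eq_square)
    then have "norm (z\<^sup>2 + of_real R ^ 2) = \<bar>Re z\<bar> * norm (Complex (Re z) (2 * Im z))"
      by (simp add: norm_mult)
    also have "\<dots> \<le> \<bar>Re z\<bar> * (3 * R)"
    proof (rule mult_left_mono)
      have "norm (Complex (Re z) (2 * Im z)) \<le> \<bar>Re z\<bar> + \<bar>2 * Im z\<bar>"
        using cmod_le[of "Complex (Re z) (2 * Im z)"] by simp
      then show "norm (Complex (Re z) (2 * Im z)) \<le> 3 * R" using z by simp
    qed simp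
    finally show ?thesis by (simp add: mult_ac)
  qed
  have "(1 + z\<^sup>2 / of_real R ^ 2) / z = (z\<^sup>2 + of_real R ^ 2) / (of_real R ^ 2 * z)"
    using R zR by (auto simp: field_simps)
  then have "norm ((1 + z\<^sup>2 / of_real R ^ 2) / z) = norm (z\<^sup>2 + of_real R ^ 2) / (R\<^sup>2 * norm z)"
    by (simp add: norm_divide norm_mult norm_power)
  also have "\<dots> \<le> (3 * R * \<bar>Re z\<bar>) / (R\<^sup>2 * R)"
    using * zR R by (intro frac_le) auto
  also have "\<dots> = 3 * \<bar>Re z\<bar> / R\<^sup>2" using R by simp
  finally show ?thesis .
qed

text \<open>
  Newman's contour method on rectangles: the kernel \<open>N powr z * (1 + z\<^sup>2 / R\<^sup>2) / z\<close> has residue 1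
  at 0. On the right half of the boundary it is paired with the tail of the series, on the left half
  the partial sum (an entire function) and \<open>f\<close> are integrated separately, and the factor
  \<open>1 + z\<^sup>2 / R\<^sup>2\<close>, which vanishes at \<open>\<plusminus> \<i> R\<close>, cancels the growth of both near the
  imaginary axis.
\<close>

lemma newman_estimate:
  fixes a :: "nat \<Rightarrow> complex" and f :: "complex \<Rightarrow> complex" and R d M :: real and N :: nat
  assumes a: "\<And>n. norm (a n) \<le> 1"
    and N: "N \<ge> 1" and R: "R \<ge> 1" "R \<le> real N" and d: "0 < d" "d \<le> R" and M: "M \<ge> 0"
    and S: "open S" "convex S" "cbox (Complex (-d) (-R)) (Complex R R) \<subseteq> S"
    and holf: "f holomorphic_on S"
    and sumsf: "\<And>z. Re z > 0 \<Longrightarrow> (\<lambda>n. a n * of_nat (Suc n) powr (-1 - z)) sums f z"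
    and leM: "\<And>z. Re z \<in> {-d..0} \<Longrightarrow> Im z \<in> {-R..R} \<Longrightarrow> norm (f z) \<le> M"
  shows "norm (f 0 - (\<Sum>n<N. a n / of_nat (Suc n)))
           \<le> 6 / R + M * d\<^sup>2 / R\<^sup>2 + M * R * real N powr (-d) / d"
proof -
  define P where "P z = (\<Sum>n<N. a n * of_nat (Suc n) powr (-1 - z))" for z
  define k where "k z = of_nat N powr z * (1 + z\<^sup>2 / of_real R ^ 2)" for z :: complex
  define gf where "gf z = f z * k z / (z - 0)" for z
  define gP where "gP z = P z * k z / (z - 0)" for z
  have Npos: "real N > 0" "N > 0" and Rpos: "R > 0" using N R by auto
  have holk: "k holomorphic_on A" for A
    using Npos unfolding k_def by (intro holomorphic_intros) auto
  have holP: "P holomorphic_on A" for A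
    unfolding P_def by (auto intro!: holomorphic_intros)
  have k0: "k 0 = 1" using Npos by (simp add: k_def)

  have pimg: "path_image (rectpath (Complex (-e) (-R)) (Complex R R))
      \<subseteq> cbox (Complex (-e) (-R)) (Complex R R) - {0}" if "e > 0" for e
    using that Rpos by (auto simp: path_image_rectpath in_cbox_complex_iff)
  \<comment> \<open>Used with \<open>f\<close> on the rectangle of left width \<open>d\<close> and
    with the entire function \<open>P\<close> on the square; the residue is the value at 0 because
    \<open>k 0 = 1\<close>.\<close>
  have cauchy: "contour_integral (rectpath (Complex (-e) (-R)) (Complex R R)) (\<lambda>z. h z * k z / (z - 0)) = 2 * pi * \<i> * h 0"
    if "e > 0" "open T" "convex T" "cbox (Complex (-e) (-R)) (Complex R R) \<subseteq> T" "h holomorphic_on T" for e T h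
  proof -
    let ?r = "rectpath (Complex (-e) (-R)) (Complex R R)"
    have "0 \<in> cbox (Complex (-e) (-R)) (Complex R R)" "0 \<in> box (Complex (-e) (-R)) (Complex R R)"
      using that Rpos by (auto simp: in_cbox_complex_iff in_box_complex_iff)
    have "((\<lambda>w. (h w * k w) / (w - 0)) has_contour_integral 2 * pi * \<i> * winding_number ?r 0 * (h 0 * k 0)) ?r"
    proof (rule Cauchy_integral_formula_convex_simple[OF that(3)])
      show "(\<lambda>w. h w * k w) holomorphic_on T" using that(5) holk by (intro holomorphic_intros)
      show "0 \<in> interior T" using that(2,4) \<open>0 \<in> cbox _ _\<close> by (auto simp: interior_open)
      show "path_image ?r \<subseteq> T - {0}" using pimg[OF that(1)] that(4) by blast
    qed auto
    moreover have "winding_number ?r 0 = 1" by (rule winding_number_rectpath) fact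
    ultimately show ?thesis using k0 by (simp add: contour_integral_unique)
  qed

  have cgf: "continuous_on (cbox (Complex (-d) (-R)) (Complex R R) - {0}) gf"
    unfolding gf_def
    by (intro continuous_intros continuous_on_subset[OF holomorphic_on_imp_continuous_on[OF holf]]
          holomorphic_on_imp_continuous_on holk) (use S in auto)
  have cgP: "continuous_on (UNIV - {0}) gP"
    unfolding gP_def
    by (intro continuous_intros holomorphic_on_imp_continuous_on holk holP) auto

  have right_sub: "{z. Re z \<in> {0..R} \<and> \<bar>Im z\<bar> = R \<or> Re z = R \<and> Im z \<in> {-R..R}}
      \<subseteq> cbox (Complex (-d) (-R)) (Complex R R) - {0}"
    using Rpos d by (auto simp: in_cbox_complex_iff)

  have ef: "newman_right R gf + newman_left R d gf = 2 * pi * \<i> * f 0"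
    using contour_integral_rectpath_split[OF Rpos d(1), of gf] cauchy[OF d(1) S holf]
      continuous_on_subset[OF cgf pimg[OF d(1)]] by (simp add: gf_def[abs_def])
  have cgP': "continuous_on (path_image (rectpath (Complex (-R) (-R)) (Complex R R))) gP"
    using pimg[OF Rpos] by (intro continuous_on_subset[OF cgP]) auto
  have eP: "newman_right R gP + newman_left R R gP = 2 * pi * \<i> * P 0"
    using contour_integral_rectpath_split[OF Rpos Rpos cgP'] cauchy[OF Rpos, of UNIV P] holP
    by (simp add: gP_def[abs_def])
  have right_diff: "newman_right R gf - newman_right R gP = newman_right R (\<lambda>z. gf z - gP z)"
  proof -
    have ci: "gf contour_integrable_on (linepath u v) \<and> gP contour_integrable_on (linepath u v)"
      if "closed_segment u v \<subseteq> cbox (Complex (-d) (-R)) (Complex R R) - {0}" for u v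
      using that by (auto intro!: contour_integrable_continuous_linepath continuous_on_subset[OF cgf]
          continuous_on_subset[OF cgP])
    have "closed_segment (Complex 0 (-R)) (Complex R (-R)) \<subseteq> cbox (Complex (-d) (-R)) (Complex R R) - {0}"
      using Rpos d by (auto simp: closed_segment_horizontal in_cbox_complex_iff)
    moreover have "closed_segment (Complex R (-R)) (Complex R R) \<subseteq> cbox (Complex (-d) (-R)) (Complex R R) - {0}"
      using Rpos d by (auto simp: closed_segment_vertical in_cbox_complex_iff)
    moreover have "closed_segment (Complex R R) (Complex 0 R) \<subseteq> cbox (Complex (-d) (-R)) (Complex R R) - {0}"
      using Rpos d by (auto simp: closed_segment_commute[of "Complex R R"] closed_segment_horizontal in_cbox_complex_iff)
    ultimately show ?thesis
      using ci unfolding newman_right_def by (simp add: contour_integral_diff)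
  qed

  have kz: "norm (k z / z) \<le> real N powr Re z * (3 * \<bar>Re z\<bar> / R\<^sup>2)"
    if "\<bar>Re z\<bar> \<le> R" "\<bar>Im z\<bar> \<le> R" "\<bar>Re z\<bar> = R \<or> \<bar>Im z\<bar> = R" for z
  proof -
    have "norm (k z / z) = real N powr Re z * norm ((1 + z\<^sup>2 / of_real R ^ 2) / z)"
      unfolding k_def by (simp add: norm_mult norm_divide norm_of_nat_powr Npos)
    also have "\<dots> \<le> real N powr Re z * (3 * \<bar>Re z\<bar> / R\<^sup>2)"
      by (rule mult_left_mono[OF norm_one_plus_div_le[OF Rpos that]]) auto
    finally show ?thesis .
  qed

  \<comment> \<open>The power of \<open>N\<close> is the inverse of the one in \<open>k\<close>, so
    the product of tail and kernel is bounded uniformly in \<open>N\<close>.\<close>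
  have tail: "norm (f z - P z) \<le> real N powr (- Re z) / Re z" if "Re z > 0" for z
  proof -
    let ?c = "\<lambda>n. a n * of_nat (Suc n) powr (-1 - z)"
    have s: "(\<lambda>n. ?c (n + N)) sums (f z - P z)"
      using sums_split_initial_segment[OF sumsf[OF that], of N] by (simp add: P_def)
    have le: "norm (?c (n + N)) \<le> real (N + n + 1) powr (-1 - Re z)" for n
    proof -
      have "norm (?c (n + N)) = norm (a (n + N)) * real (Suc (n + N)) powr (Re (-1 - z))"
        by (simp add: norm_mult norm_of_nat_powr del: of_nat_Suc)
      also have "\<dots> \<le> 1 * real (Suc (n + N)) powr (Re (-1 - z))"
        by (intro mult_right_mono a) auto
      finally show ?thesis by (simp add: add_ac)
    qed
    have "norm (f z - P z) = norm (\<Sum>n. ?c (n + N))" using sums_unique[OF s] by simp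
    also have "\<dots> \<le> (\<Sum>n. real (N + n + 1) powr (-1 - Re z))"
      by (rule norm_suminf_le[OF le powr_tail(1)[OF that Npos(2)]])
    also have "\<dots> \<le> real N powr (- Re z) / Re z" by (rule powr_tail(2)[OF that Npos(2)])
    finally show ?thesis .
  qed
  have partial: "norm (P z) \<le> real N powr (- Re z) * (2 / - Re z)" if "Re z < 0" "- Re z \<le> R" for z
  proof -
    have "norm (P z) \<le> (\<Sum>n<N. real (Suc n) powr (- Re z - 1))"
      unfolding P_def
    proof (rule sum_norm_le)
      fix n
      have "norm (a n * of_nat (Suc n) powr (-1 - z)) = norm (a n) * real (Suc n) powr (Re (-1 - z))"
        by (simp add: norm_mult norm_of_nat_powr del: of_nat_Suc)
      also have "\<dots> \<le> 1 * real (Suc n) powr (Re (-1 - z))"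
        by (intro mult_right_mono a) auto
      also have "Re (-1 - z) = - Re z - 1" by simp
      finally show "norm (a n * of_nat (Suc n) powr (-1 - z)) \<le> real (Suc n) powr (- Re z - 1)" by simp
    qed
    also have "\<dots> \<le> real N powr (- Re z) * (1 / real N + 1 / - Re z)"
      using that Npos by (intro powr_partial_sum) auto
    also have "\<dots> \<le> real N powr (- Re z) * (2 / - Re z)"
    proof (rule mult_left_mono)
      \<comment> \<open>This is where \<open>R \<le> N\<close> enters, through
        \<open>- Re z \<le> R \<le> N\<close>.\<close>
      have "1 / real N \<le> 1 / - Re z" using that R Npos by (intro frac_le) auto
      moreover have "2 / - Re z = 1 / - Re z + 1 / - Re z"
        by (simp only: add_divide_distrib[symmetric]) simp
      ultimately show "1 / real N + 1 / - Re z \<le> 2 / - Re z" by linarith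
    qed auto
    finally show ?thesis .
  qed

  have b1: "norm (newman_right R (\<lambda>z. gf z - gP z)) \<le> 4 * R * (3 / R\<^sup>2)"
  proof (rule newman_right_bound[OF Rpos])
    show "continuous_on {z. Re z \<in> {0..R} \<and> \<bar>Im z\<bar> = R \<or> Re z = R \<and> Im z \<in> {-R..R}} (\<lambda>z. gf z - gP z)"
      using right_sub by (intro continuous_intros continuous_on_subset[OF cgf] continuous_on_subset[OF cgP]) auto
  next
    fix z assume z: "Re z \<in> {0..R} \<and> \<bar>Im z\<bar> = R \<or> Re z = R \<and> Im z \<in> {-R..R}"
    then have re: "Re z \<ge> 0" using Rpos by auto
    have kk: "norm (k z / z) \<le> real N powr Re z * (3 * \<bar>Re z\<bar> / R\<^sup>2)"
      using z Rpos by (intro kz) auto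
    have eq: "gf z - gP z = (f z - P z) * (k z / z)" by (simp add: gf_def gP_def algebra_simps diff_divide_distrib)
    show "norm (gf z - gP z) \<le> 3 / R\<^sup>2"
    proof (cases "Re z = 0")
      case True
      with kk have "k z / z = 0" by simp
      then show ?thesis unfolding eq by (simp only: mult_zero_right) simp
    next
      case False
      with re have "norm (f z - P z) * norm (k z / z)
          \<le> (real N powr (- Re z) / Re z) * (real N powr Re z * (3 * \<bar>Re z\<bar> / R\<^sup>2))"
        by (intro mult_mono tail kk) auto
      also have "\<dots> = 3 / R\<^sup>2" using False re Npos by (simp add: powr_minus field_simps)
      finally show ?thesis unfolding eq norm_mult .
    qed
  qed (use Rpos in auto)

  have b2: "norm (newman_left R R gP) \<le> 2 * R * (6 / R\<^sup>2) + 2 * R * (6 / R\<^sup>2)"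
  proof -
    have *: "norm (gP z) \<le> 6 / R\<^sup>2" if z: "Re z \<in> {-R..0} \<and> \<bar>Im z\<bar> = R \<or> Re z = -R \<and> Im z \<in> {-R..R}" for z
    proof -
      have re: "Re z \<le> 0" "- Re z \<le> R" using Rpos z by auto
      have kk: "norm (k z / z) \<le> real N powr Re z * (3 * \<bar>Re z\<bar> / R\<^sup>2)"
        using Rpos z by (intro kz) auto
      have eq: "gP z = P z * (k z / z)" by (simp add: gP_def)
      show ?thesis
      proof (cases "Re z = 0")
        case True
        with kk have "k z / z = 0" by simp
      then show ?thesis unfolding eq by (simp only: mult_zero_right) simp
      next
        case False
        with re have "norm (P z) * norm (k z / z)
            \<le> (real N powr (- Re z) * (2 / - Re z)) * (real N powr Re z * (3 * \<bar>Re z\<bar> / R\<^sup>2))"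
          by (intro mult_mono partial kk mult_nonneg_nonneg divide_nonneg_nonneg) auto
        also have "\<dots> = 6 / R\<^sup>2" using False re Npos by (simp add: powr_minus field_simps)
        finally show ?thesis unfolding eq norm_mult .
      qed
    qed
    show ?thesis
    proof (rule newman_left_bound[OF Rpos Rpos])
      show "continuous_on {z. Re z \<in> {-R..0} \<and> \<bar>Im z\<bar> = R \<or> Re z = -R \<and> Im z \<in> {-R..R}} gP"
        using Rpos by (intro continuous_on_subset[OF cgP]) auto
    qed (use * Rpos in auto)
  qed

  \<comment> \<open>The horizontal sides have length \<open>d\<close> and a kernel of size at most
    \<open>3 * d / R\<^sup>2\<close>, whence \<open>d\<^sup>2\<close>. The vertical side gains
    \<open>N powr (-d)\<close> and loses \<open>1 / d\<close> through the division by
    \<open>z\<close>.\<close>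
  have b3: "norm (newman_left R d gf) \<le> 2 * d * (M * (3 * d / R\<^sup>2)) + 2 * R * (M * (real N powr (-d) * (3 / d)))"
  proof (rule newman_left_bound[OF Rpos d(1)])
    show "continuous_on {z. Re z \<in> {-d..0} \<and> \<bar>Im z\<bar> = R \<or> Re z = -d \<and> Im z \<in> {-R..R}} gf"
      using Rpos d by (intro continuous_on_subset[OF cgf]) (auto simp: in_cbox_complex_iff)
  next
    fix z assume z: "Re z \<in> {-d..0}" "\<bar>Im z\<bar> = R"
    have "norm (gf z) = norm (f z) * norm (k z / z)" by (simp add: gf_def norm_mult norm_divide)
    also have "\<dots> \<le> M * (1 * (3 * d / R\<^sup>2))"
    proof (rule mult_mono)
      show "norm (f z) \<le> M" using z Rpos by (intro leM) auto
      have "norm (k z / z) \<le> real N powr Re z * (3 * \<bar>Re z\<bar> / R\<^sup>2)" using z d by (intro kz) auto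
      also have "\<dots> \<le> 1 * (3 * d / R\<^sup>2)"
      proof (rule mult_mono)
        show "real N powr Re z \<le> 1" using z N powr_mono[of "Re z" 0 "real N"] by simp
        show "3 * \<bar>Re z\<bar> / R\<^sup>2 \<le> 3 * d / R\<^sup>2" by (rule divide_right_mono) (use z d in auto)
        show "0 \<le> 3 * \<bar>Re z\<bar> / R\<^sup>2" by simp
      qed simp
      finally show "norm (k z / z) \<le> 1 * (3 * d / R\<^sup>2)" .
    qed (use M in auto)
    finally show "norm (gf z) \<le> M * (3 * d / R\<^sup>2)" by simp
  next
    fix z assume z: "Re z = -d" "Im z \<in> {-R..R}"
    have zd: "norm z \<ge> d" using abs_Re_le_cmod[of z] z d by simp
    have zsq: "(norm z)\<^sup>2 \<le> 2 * R\<^sup>2"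
    proof -
      have "(Re z)\<^sup>2 \<le> R\<^sup>2" using z d by (auto intro!: power_mono)
      moreover have "(Im z)\<^sup>2 \<le> R\<^sup>2" using z(2) Rpos by (metis abs_le_iff abs_le_square_iff abs_of_pos atLeastAtMost_iff minus_le_iff)
      ultimately show ?thesis by (simp add: cmod_power2)
    qed
    have "norm (1 + z\<^sup>2 / of_real R ^ 2) \<le> 1 + (norm z)\<^sup>2 / R\<^sup>2"
      by (rule order_trans[OF norm_triangle_ineq]) (simp add: norm_divide norm_power)
    also have "\<dots> \<le> 3" using zsq Rpos by (simp add: field_simps)
    finally have 3: "norm (1 + z\<^sup>2 / of_real R ^ 2) \<le> 3" .
    have "norm (gf z) = norm (f z) * (real N powr Re z * (norm (1 + z\<^sup>2 / of_real R ^ 2) / norm z))"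
      by (simp add: gf_def k_def norm_mult norm_divide norm_of_nat_powr Npos)
    also have "\<dots> \<le> M * (real N powr (-d) * (3 / d))"
      using 3 zd d z Rpos M by (intro mult_mono frac_le leM) auto
    finally show "norm (gf z) \<le> M * (real N powr (-d) * (3 / d))" .
  qed (use M d Rpos in auto)

  \<comment> \<open>Subtracting the two residue identities merges the right halves into one integral
    of the tail and leaves the left halves separate.\<close>
  have "2 * pi * \<i> * (f 0 - P 0) = newman_right R (\<lambda>z. gf z - gP z) + newman_left R d gf - newman_left R R gP"
    unfolding right_diff_distrib ef[symmetric] eP[symmetric] right_diff[symmetric] by simp
  then have "2 * pi * norm (f 0 - P 0) = norm (newman_right R (\<lambda>z. gf z - gP z) + newman_left R d gf - newman_left R R gP)"
    by (metis norm_mult norm_of_real norm_ii mult.right_neutral abs_of_pos pi_gt_zero norm_numeral of_real_mult of_real_numeral)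
  also have "\<dots> \<le> 4 * R * (3 / R\<^sup>2) + (2 * d * (M * (3 * d / R\<^sup>2)) + 2 * R * (M * (real N powr (-d) * (3 / d))))
       + (2 * R * (6 / R\<^sup>2) + 2 * R * (6 / R\<^sup>2))"
    by (rule order_trans[OF norm_triangle_ineq4] order_trans[OF add_mono[OF norm_triangle_ineq order_refl]] add_mono b1 b2 b3)+
  also have "\<dots> = 6 * (6 / R + M * d\<^sup>2 / R\<^sup>2 + M * R * real N powr (-d) / d)"
    using Rpos d by (simp add: field_simps power2_eq_square)
  finally have fin: "2 * pi * norm (f 0 - P 0) \<le> 6 * (6 / R + M * d\<^sup>2 / R\<^sup>2 + M * R * real N powr (-d) / d)" .
  \<comment> \<open>Replacing \<open>2 * pi\<close> by 6 cancels the common factor 6.\<close>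
  have "6 * norm (f 0 - P 0) \<le> 2 * pi * norm (f 0 - P 0)"
    using pi_gt3 by (intro mult_right_mono) auto
  from mult_left_le_imp_le[OF order_trans[OF this fin]]
  have "norm (f 0 - P 0) \<le> 6 / R + M * d\<^sup>2 / R\<^sup>2 + M * R * real N powr (-d) / d" by simp
  moreover have "P 0 = (\<Sum>n<N. a n / of_nat (Suc n))"
    unfolding P_def by (intro sum.cong refl) (simp add: powr_minus divide_inverse powr_neg_one' del: of_nat_Suc)
  ultimately show ?thesis by simp
qed

section \<open>The zeta function near the line Re s = 1\<close>

text \<open>This is \<open>s - 1\<close> times the difference between
  \<open>of_nat n powr (-s)\<close> and the integral of \<open>w powr (-s)\<close> from
  \<open>n\<close> to \<open>n + 1\<close>, multiplied out so that no division by
  \<open>s - 1\<close> occurs.\<close>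

definition zeta_term :: "nat \<Rightarrow> complex \<Rightarrow> complex" where
  "zeta_term n s = (s - 1) * of_nat n powr (-s) + of_nat (Suc n) powr (1 - s) - of_nat n powr (1 - s)"

text \<open>
  \<open>zeta_reg s\<close> is \<open>(s - 1) \<zeta>(s)\<close>, continued to the half plane \<open>Re s > 0\<close>. Multiplying by
  \<open>s - 1\<close> makes every summand entire, so that \<open>s = 1\<close> needs no special treatment.
\<close>

definition zeta_reg :: "complex \<Rightarrow> complex" where
  "zeta_reg s = 1 + (\<Sum>k. zeta_term (Suc k) s)"

definition zeta :: "complex \<Rightarrow> complex" where
  "zeta s = zeta_reg s / (s - 1)"

text \<open>The summand is an increment of \<open>?\<phi>\<close>, whose derivative is
  \<open>(s - 1) * (of_nat n powr (-s) - w powr (-s))\<close>; a second mean value estimate bounds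
  that difference. The power of \<open>n\<close> gained in this way makes the series converge for
  \<open>Re s > 0\<close>.\<close>

lemma norm_zeta_term_le:
  assumes n: "n > 0" and s: "Re s \<ge> 0"
  shows "norm (zeta_term n s) \<le> norm (s - 1) * norm s * real n powr (-1 - Re s)"
proof -
  define S where "S = closed_segment (Complex (real n) 0) (Complex (real n + 1) 0)"
  have S: "S = {z. Im z = 0 \<and> Re z \<in> {real n..real n + 1}}"
    unfolding S_def by (rule closed_segment_horizontal) simp
  have convS: "convex S" unfolding S_def by simp
  have nS: "of_nat n \<in> S" "of_nat (Suc n) \<in> S" by (auto simp: S)
  have npos: "w \<notin> \<real>\<^sub>\<le>\<^sub>0" if "w \<in> S" for w
    using that n by (auto simp: S complex_nonpos_Reals_iff)
  have diff: "norm (of_nat n powr (-s) - w powr (-s)) \<le> norm s * real n powr (-1 - Re s)" if w: "w \<in> S" for w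
  proof -
    have "norm (w powr (-s) - of_nat n powr (-s)) \<le> norm s * real n powr (-1 - Re s) * norm (w - of_nat n)"
    proof (rule field_differentiable_bound[OF convS _ _ w nS(1)])
      fix z assume z: "z \<in> S"
      show "((\<lambda>z. z powr (-s)) has_field_derivative (-s) * z powr (-s - 1)) (at z within S)"
        by (rule has_field_derivative_at_within[OF has_field_derivative_powr[OF npos[OF z]]])
      have "norm (z powr (-s - 1)) = Re z powr (-1 - Re s)"
      proof -
        have "norm (z powr (-s - 1)) = Re z powr Re (-s - 1)"
          using z n by (intro norm_powr_real_powr) (auto simp: S complex_is_Real_iff)
        also have "Re (-s - 1) = -1 - Re s" by simp
        finally show ?thesis .
      qed
      also have "\<dots> \<le> real n powr (-1 - Re s)"
        using z n s by (intro powr_mono2') (auto simp: S)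
      finally show "norm ((-s) * z powr (-s - 1)) \<le> norm s * real n powr (-1 - Re s)"
        by (simp add: norm_mult mult_left_mono)
    qed
    also have "\<dots> \<le> norm s * real n powr (-1 - Re s) * 1"
    proof (rule mult_left_mono)
      have "w - of_nat n = of_real (Re w - real n)" using w by (auto simp: S complex_eq_iff)
      then have "norm (w - of_nat n) = \<bar>Re w - real n\<bar>" by (metis norm_of_real)
      then show "norm (w - of_nat n) \<le> 1" using w by (auto simp: S)
    qed auto
    finally show ?thesis by (simp add: norm_minus_commute)
  qed
  let ?\<phi> = "\<lambda>w. (s - 1) * of_nat n powr (-s) * w + w powr (1 - s)"
  have "norm (?\<phi> (of_nat (Suc n)) - ?\<phi> (of_nat n))
      \<le> norm (s - 1) * norm s * real n powr (-1 - Re s) * norm (of_nat (Suc n) - of_nat n :: complex)"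
  proof (rule field_differentiable_bound[OF convS _ _ nS(2,1)])
    fix z assume z: "z \<in> S"
    show "(?\<phi> has_field_derivative (s - 1) * of_nat n powr (-s) * 1 + (1 - s) * z powr (1 - s - 1)) (at z within S)"
      using npos[OF z]
      by (intro DERIV_add DERIV_cmult DERIV_ident has_field_derivative_at_within[OF has_field_derivative_powr])
    have "(s - 1) * of_nat n powr (-s) * 1 + (1 - s) * z powr (1 - s - 1)
        = (s - 1) * (of_nat n powr (-s) - z powr (-s))"
      by (simp add: algebra_simps)
    then show "norm ((s - 1) * of_nat n powr (-s) * 1 + (1 - s) * z powr (1 - s - 1))
        \<le> norm (s - 1) * norm s * real n powr (-1 - Re s)"
      using diff[OF z] by (simp add: norm_mult mult_left_mono mult.assoc)
  qed
  moreover have "?\<phi> (of_nat (Suc n)) - ?\<phi> (of_nat n) = zeta_term n s"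
    by (simp add: zeta_term_def algebra_simps)
  ultimately show ?thesis by simp
qed

lemma summable_zeta_term:
  assumes s: "Re s > 0"
  shows "summable (\<lambda>k. zeta_term (Suc k) s)"
proof (rule summable_comparison_test')
  have "summable (\<lambda>k. real (1 + k + 1) powr (-1 - Re s))" using powr_tail(1)[OF s, of 1] by simp
  then have "summable (\<lambda>k. real (Suc (Suc k)) powr (-1 - Re s))" by simp
  then have "summable (\<lambda>k. real (Suc k) powr (-1 - Re s))" by (subst (asm) summable_Suc_iff)
  then show "summable (\<lambda>k. norm (s - 1) * norm s * real (Suc k) powr (-1 - Re s))"
    by (rule summable_mult)
  show "norm (zeta_term (Suc n) s) \<le> norm (s - 1) * norm s * real (Suc n) powr (-1 - Re s)" for n
    by (rule norm_zeta_term_le) (use s in auto)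
qed

lemma sum_zeta_term:
  "(\<Sum>k<M. zeta_term (Suc k) s) = (s - 1) * (\<Sum>k<M. of_nat (Suc k) powr (-s)) + of_nat (Suc M) powr (1 - s) - 1"
  by (induction M) (simp_all add: zeta_term_def ring_distribs del: of_nat_Suc, simp)

text \<open>The first \<open>M\<close> summands telescope to a partial sum of the zeta series plus a
  boundary term, and \<open>powr_tail\<close> bounds the rest. The free \<open>M\<close> will be
  matched to the height \<open>Im s\<close>.\<close>

lemma zeta_reg_approx:
  assumes s: "Re s > 0" and M: "M > 0"
  shows "norm (zeta_reg s - ((s - 1) * (\<Sum>k<M. of_nat (Suc k) powr (-s)) + of_nat (Suc M) powr (1 - s)))
           \<le> norm (s - 1) * norm s * (real M powr (- Re s) / Re s)"
proof -
  have "zeta_reg s - ((s - 1) * (\<Sum>k<M. of_nat (Suc k) powr (-s)) + of_nat (Suc M) powr (1 - s))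
      = (\<Sum>k. zeta_term (Suc (k + M)) s)"
    using suminf_split_initial_segment[OF summable_zeta_term[OF s], of M] sum_zeta_term[of s M]
    by (simp add: zeta_reg_def)
  also have "norm \<dots> \<le> (\<Sum>k. norm (s - 1) * norm s * real (M + k + 1) powr (-1 - Re s))"
  proof (rule norm_suminf_le)
    show "summable (\<lambda>k. norm (s - 1) * norm s * real (M + k + 1) powr (-1 - Re s))"
      by (intro summable_mult powr_tail s M)
    show "norm (zeta_term (Suc (n + M)) s) \<le> norm (s - 1) * norm s * real (M + n + 1) powr (-1 - Re s)" for n
      using norm_zeta_term_le[of "Suc (n + M)" s] s by (simp add: add_ac)
  qed
  also have "\<dots> = norm (s - 1) * norm s * (\<Sum>k. real (M + k + 1) powr (-1 - Re s))"
    by (rule suminf_mult) (intro powr_tail s M)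
  also have "\<dots> \<le> norm (s - 1) * norm s * (real M powr (- Re s) / Re s)"
    by (intro mult_left_mono powr_tail s M) auto
  finally show ?thesis .
qed

text \<open>The approximation at \<open>M = 1\<close>, with the first summand estimated separately.
  It controls \<open>zeta_reg\<close> around the pole of zeta.\<close>

lemma zeta_reg_near_1:
  assumes s: "Re s > 0"
  shows "norm (zeta_reg s - 1) \<le> norm (s - 1) * norm s * (1 + 1 / Re s)"
proof -
  have "zeta_reg s - 1 = (zeta_reg s - ((s - 1) * (\<Sum>k<1. of_nat (Suc k) powr (-s)) + of_nat (Suc 1) powr (1 - s)))
     + zeta_term 1 s"
    by (simp add: zeta_term_def)
  also have "norm \<dots> \<le> norm (s - 1) * norm s * (real 1 powr (- Re s) / Re s) + norm (s - 1) * norm s * real 1 powr (-1 - Re s)"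
    by (intro order_trans[OF norm_triangle_ineq] add_mono zeta_reg_approx norm_zeta_term_le) (use s in auto)
  finally show ?thesis by (simp add: algebra_simps)
qed

lemma holomorphic_zeta_reg: "zeta_reg holomorphic_on {s. Re s > 0}"
proof (rule holomorphic_uniform_sequence)
  show "open {s. Re s > 0}" by (rule open_halfspace_Re_gt)
  show "(\<lambda>s. 1 + (\<Sum>k<M. zeta_term (Suc k) s)) holomorphic_on {s. Re s > 0}" for M
    unfolding zeta_term_def by (auto intro!: holomorphic_intros)
  fix x :: complex assume "x \<in> {s. Re s > 0}"
  then have x: "Re x > 0" by simp
  \<comment> \<open>Half the distance to the imaginary axis, so that \<open>Re s \<ge> c\<close> on
    the whole ball.\<close>
  define c where "c = Re x / 2"
  define C where "C = (norm x + c + 1) * (norm x + c)"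
  have c: "c > 0" using x by (simp add: c_def)
  have sub: "Re s \<ge> c" if "s \<in> cball x c" for s
    using that abs_Re_le_cmod[of "x - s"] by (auto simp: dist_norm c_def)
  have ul: "uniform_limit (cball x c) (\<lambda>M s. \<Sum>k<M. zeta_term (Suc k) s) (\<lambda>s. \<Sum>k. zeta_term (Suc k) s) sequentially"
  proof (rule Weierstrass_m_test)
    fix k s assume s: "s \<in> cball x c"
    have ns: "norm s \<le> norm x + c"
      using s norm_triangle_ineq2[of s x] by (auto simp: dist_norm norm_minus_commute)
    have "norm (zeta_term (Suc k) s) \<le> norm (s - 1) * norm s * real (Suc k) powr (-1 - Re s)"
      by (rule norm_zeta_term_le) (use sub[OF s] c in auto)
    also have "\<dots> \<le> C * real (Suc k) powr (-1 - c)"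
      unfolding C_def using ns norm_triangle_ineq4[of s 1] sub[OF s] c
      by (intro mult_mono powr_mono) auto
    finally show "norm (zeta_term (Suc k) s) \<le> C * real (Suc k) powr (-1 - c)" .
  next
    have "summable (\<lambda>k. real (1 + k + 1) powr (-1 - c))" using powr_tail(1)[OF c, of 1] by simp
    then have "summable (\<lambda>k. real (Suc (Suc k)) powr (-1 - c))" by simp
    then have "summable (\<lambda>k. real (Suc k) powr (-1 - c))" by (subst (asm) summable_Suc_iff)
    then show "summable (\<lambda>k. C * real (Suc k) powr (-1 - c))" by (rule summable_mult)
  qed
  show "\<exists>d>0. cball x d \<subseteq> {s. Re s > 0} \<and>
      uniform_limit (cball x d) (\<lambda>M s. 1 + (\<Sum>k<M. zeta_term (Suc k) s)) zeta_reg sequentially"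
  proof (intro exI[of _ c] conjI c)
    show "cball x c \<subseteq> {s. Re s > 0}" using sub c by force
    show "uniform_limit (cball x c) (\<lambda>M s. 1 + (\<Sum>k<M. zeta_term (Suc k) s)) zeta_reg sequentially"
      unfolding zeta_reg_def[abs_def] by (intro uniform_limit_intros ul)
  qed
qed

lemma holomorphic_zeta: "zeta holomorphic_on {s. Re s > 0} - {1}"
  unfolding zeta_def[abs_def]
  by (intro holomorphic_intros holomorphic_on_subset[OF holomorphic_zeta_reg]) auto

text \<open>For \<open>Re s > 1\<close> the boundary terms tend to 0, so the telescoping differences
  sum to -1 and cancel the leading 1 of \<open>zeta_reg\<close>.\<close>

lemma zeta_sums:
  assumes s: "Re s > 1"
  shows "(\<lambda>k. of_nat (Suc k) powr (-s)) sums zeta s"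
proof -
  have t: "(\<lambda>k. zeta_term (Suc k) s) sums (zeta_reg s - 1)"
    using summable_sums[OF summable_zeta_term[of s]] s by (simp add: zeta_reg_def)
  have "(\<lambda>M. (of_nat (Suc M) :: complex) powr (1 - s)) \<longlonglongrightarrow> 0"
  proof (rule tendsto_norm_zero_cancel)
    have "(\<lambda>M. real (Suc M) powr (1 - Re s)) \<longlonglongrightarrow> 0" using s by real_asymp
    then show "(\<lambda>M. norm ((of_nat (Suc M) :: complex) powr (1 - s))) \<longlonglongrightarrow> 0"
      by (simp add: norm_of_nat_powr del: of_nat_Suc)
  qed
  from telescope_sums[OF this]
  have "(\<lambda>k. of_nat (Suc (Suc k)) powr (1 - s) - of_nat (Suc k) powr (1 - s)) sums (0 - (1::complex))"
    by simp
  from sums_diff[OF t this]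
  have "(\<lambda>k. (s - 1) * of_nat (Suc k) powr (-s)) sums zeta_reg s"
    by (simp add: zeta_term_def del: of_nat_Suc)
  moreover have s1: "s \<noteq> 1" using s by auto
  ultimately show ?thesis using sums_divide[of _ "zeta_reg s" "s - 1"]
    by (fastforce simp: zeta_def simp del: of_nat_Suc)
qed

section \<open>The Euler product and the 3-4-1 inequality\<close>

lemma of_nat_mult_powr:
  "(of_nat (a * b) :: complex) powr z = of_nat a powr z * of_nat b powr z"
proof -
  have "(of_real (real a) * of_real (real b) :: complex) powr z = of_real (real a) powr z * of_real (real b) powr z"
    by (intro powr_times_real) auto
  then show ?thesis by simp
qed

lemma has_sum_nat_powr:
  assumes s: "Re s > 1"
  shows "((\<lambda>n. of_nat n powr (-s)) has_sum zeta s) {n::nat. n > 0}"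
proof -
  have "summable (\<lambda>k. norm ((of_nat (Suc k) :: complex) powr (-s)))"
  proof -
    have "summable (\<lambda>k. real (1 + k + 1) powr (-1 - (Re s - 1)))" using powr_tail(1)[of "Re s - 1" 1] s by simp
    then have "summable (\<lambda>k. real (Suc (Suc k)) powr (- Re s))" by simp
    then have "summable (\<lambda>k. real (Suc k) powr (- Re s))" by (subst (asm) summable_Suc_iff)
    then show ?thesis by (simp add: norm_of_nat_powr del: of_nat_Suc)
  qed
  then have "((\<lambda>k. of_nat (Suc k) powr (-s)) has_sum zeta s) UNIV"
    using zeta_sums[OF s] by (rule norm_summable_imp_has_sum)
  then have "((\<lambda>n. of_nat n powr (-s)) has_sum zeta s) (Suc ` UNIV)"
    by (subst has_sum_reindex) (auto simp: o_def)
  also have "Suc ` UNIV = {n. n > 0}" by (auto simp: image_def gr0_conv_Suc)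
  finally show ?thesis .
qed

text \<open>Sieve of Eratosthenes: among the remaining numbers, the multiples of \<open>p\<close>
  carry the fraction \<open>of_nat p powr (-s)\<close> of the sum, so discarding them multiplies it
  by \<open>1 - of_nat p powr (-s)\<close>.\<close>

lemma has_sum_rough_powr:
  assumes s: "Re s > 1" and "finite A" and "\<And>p. p \<in> A \<Longrightarrow> prime p"
  shows "((\<lambda>n. of_nat n powr (-s)) has_sum (zeta s * (\<Prod>p\<in>A. 1 - of_nat p powr (-s))))
           {n::nat. n > 0 \<and> (\<forall>p\<in>A. \<not> p dvd n)}"
  using assms(2,3)
proof (induction A rule: finite_induct)
  case empty
  then show ?case using has_sum_nat_powr[OF s] by simp
next
  case (insert p A)
  let ?f = "\<lambda>n::nat. of_nat n powr (-s) :: complex"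
  let ?B = "{n::nat. n > 0 \<and> (\<forall>p\<in>A. \<not> p dvd n)}"
  let ?S = "zeta s * (\<Prod>p\<in>A. 1 - of_nat p powr (-s))"
  have p: "prime p" using insert by auto
  have IH: "(?f has_sum ?S) ?B" using insert by auto
  have "((\<lambda>n. of_nat p powr (-s) * ?f n) has_sum (of_nat p powr (-s) * ?S)) ?B"
    by (rule has_sum_cmult_right[OF IH])
  then have "((\<lambda>n. ?f (p * n)) has_sum (of_nat p powr (-s) * ?S)) ?B"
    by (simp add: of_nat_mult_powr del: of_nat_mult)
  then have "(?f has_sum (of_nat p powr (-s) * ?S)) ((*) p ` ?B)"
    using p by (subst has_sum_reindex) (auto simp: o_def inj_on_def prime_gt_0_nat simp del: of_nat_mult)
  moreover have "(*) p ` ?B = {n \<in> ?B. p dvd n}"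
  proof -
    have "q dvd p * m \<longleftrightarrow> q dvd m" if "q \<in> A" for q m
    proof -
      have "prime q" "q \<noteq> p" using that insert by auto
      then have "\<not> q dvd p" using p primes_dvd_imp_eq by blast
      then show ?thesis using \<open>prime q\<close> by (simp add: prime_dvd_mult_iff)
    qed
    note dvd = this
    show ?thesis
    proof (intro equalityI subsetI)
      fix n assume "n \<in> (*) p ` ?B"
      then show "n \<in> {n \<in> ?B. p dvd n}" using p dvd by (auto simp: prime_gt_0_nat)
    next
      fix n assume n: "n \<in> {n \<in> ?B. p dvd n}"
      then obtain m where m: "n = p * m" by (auto elim: dvdE)
      then have "m \<in> ?B" using n dvd by auto
      then show "n \<in> (*) p ` ?B" using m by blast
    qed
  qed
  ultimately have "(?f has_sum (?S - of_nat p powr (-s) * ?S)) (?B - {n \<in> ?B. p dvd n})"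
    using IH by (intro has_sum_Diff) auto
  also have "?B - {n \<in> ?B. p dvd n} = {n. n > 0 \<and> (\<forall>p\<in>insert p A. \<not> p dvd n)}" by auto
  also have "?S - of_nat p powr (-s) * ?S = zeta s * (\<Prod>p\<in>insert p A. 1 - of_nat p powr (-s))"
    using insert by (simp add: algebra_simps)
  finally show ?case .
qed

text \<open>After sieving by all primes up to \<open>N\<close>, only 1 and numbers above
  \<open>N\<close> remain, so the error is dominated by a tail of the series.\<close>

lemma euler_product_tendsto:
  assumes s: "Re s > 1"
  shows "(\<lambda>N. zeta s * (\<Prod>p | prime p \<and> p \<le> N. 1 - of_nat p powr (-s))) \<longlonglongrightarrow> 1"
proof -
  let ?f = "\<lambda>n::nat. of_nat n powr (-s) :: complex"
  let ?E = "\<lambda>N. zeta s * (\<Prod>p | prime p \<and> p \<le> N. 1 - of_nat p powr (-s))"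
  have bound: "norm (?E N - 1) \<le> real N powr (- (Re s - 1)) / (Re s - 1)" if N: "N > 0" for N
  proof -
    let ?B = "{n::nat. n > 0 \<and> (\<forall>p\<in>{p. prime p \<and> p \<le> N}. \<not> p dvd n)}"
    have fin: "finite {p. prime p \<and> p \<le> N}" by (rule finite_subset[of _ "{..N}"]) auto
    have hs: "(?f has_sum ?E N) ?B" by (rule has_sum_rough_powr[OF s fin]) auto
    have "1 \<in> ?B" by auto
    then have hs1: "(?f has_sum (?E N - 1)) (?B - {1})"
      using has_sum_Diff[OF hs has_sum_finite[of "{1}" ?f]] by simp
    have sub: "?B - {1} \<subseteq> {n. n > N}"
    proof
      fix n assume n: "n \<in> ?B - {1}"
      then obtain p where p: "prime p" "p dvd n" using prime_factor_nat[of n] by auto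
      with n have "p > N" by force
      moreover have "p \<le> n" using p n by (auto intro: dvd_imp_le)
      ultimately show "n \<in> {n. n > N}" by simp
    qed
    let ?g = "\<lambda>n. real n powr (-1 - (Re s - 1))"
    have sg: "summable (\<lambda>k. ?g (N + k + 1))" using s N by (intro powr_tail) auto
    have "((\<lambda>k. ?g (N + k + 1)) has_sum (\<Sum>k. ?g (N + k + 1))) UNIV"
      by (rule norm_summable_imp_has_sum[OF _ summable_sums[OF sg]]) (use sg in simp)
    then have hg: "(?g has_sum (\<Sum>k. ?g (N + k + 1))) {n. n > N}"
    proof -
      have "(?g has_sum (\<Sum>k. ?g (N + k + 1))) ((\<lambda>k. N + k + 1) ` UNIV)"
        using \<open>(_ has_sum _) UNIV\<close> by (subst has_sum_reindex) (auto simp: o_def inj_on_def)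
      moreover have "(\<lambda>k. N + k + 1) ` UNIV = {n. n > N}"
      proof (intro equalityI subsetI)
        fix n assume "n \<in> {n. n > N}"
        then have "n = N + (n - N - 1) + 1" by simp
        then show "n \<in> (\<lambda>k. N + k + 1) ` UNIV" by blast
      qed auto
      ultimately show ?thesis by simp
    qed
    have "norm (?E N - 1) \<le> (\<Sum>k. ?g (N + k + 1))"
    proof -
      have "?g summable_on (?B - {1})"
        using has_sum_imp_summable[OF hg] sub by (rule summable_on_subset_banach)
      then have hg': "(?g has_sum infsum ?g (?B - {1})) (?B - {1})" by (rule has_sum_infsum)
      have "((\<lambda>n. norm (?f n)) has_sum infsum ?g (?B - {1})) (?B - {1})"
        by (rule has_sum_cong[THEN iffD1, OF _ hg']) (auto simp: norm_of_nat_powr)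
      then have "norm (?E N - 1) \<le> infsum ?g (?B - {1})"
        using hs1 by (rule norm_has_sum_bound)
      also have "\<dots> \<le> (\<Sum>k. ?g (N + k + 1))"
        by (rule has_sum_mono2[OF hg' hg sub]) auto
      finally show ?thesis .
    qed
    also have "\<dots> \<le> real N powr (- (Re s - 1)) / (Re s - 1)" using s N by (intro powr_tail) auto
    finally show ?thesis .
  qed
  have "(\<lambda>N. real N powr (- (Re s - 1)) / (Re s - 1)) \<longlonglongrightarrow> 0"
    using s by real_asymp
  moreover have "eventually (\<lambda>N. norm (?E N - 1) \<le> real N powr (- (Re s - 1)) / (Re s - 1)) sequentially"
    using eventually_gt_at_top[of 0] by eventually_elim (rule bound)
  ultimately have "(\<lambda>N. ?E N - 1) \<longlonglongrightarrow> 0" by (rule Lim_null_comparison[rotated])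
  then show ?thesis by (rule LIM_zero_cancel)
qed

text \<open>Expand the logarithms: with \<open>cos \<theta> = Re (w ^ n)\<close>, the coefficient of
  \<open>r ^ n / n\<close> is \<open>-(3 + 4 * cos \<theta> + cos (2 * \<theta>)) = -2 * (1 + cos
  \<theta>)\<^sup>2\<close>.\<close>

lemma norm_prod_341_le:
  fixes r :: real and w :: complex
  assumes r: "0 \<le> r" "r < 1" and w: "norm w = 1"
  shows "(1 - r) ^ 3 * norm (1 - r * w) ^ 4 * norm (1 - r * w\<^sup>2) \<le> 1"
proof -
  \<comment> \<open>The term with index 0 is 0, because division by 0 gives 0.\<close>
  have ln_sums: "(\<lambda>n. - (r ^ n * Re (v ^ n) / real n)) sums ln (norm (1 - r * v))" and nz: "norm (1 - r * v) > 0"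
    if v: "norm v = 1" for v :: complex
  proof -
    have lt: "norm (- (r * v)) < 1" using v r by (simp add: norm_mult)
    then have nz: "1 - r * v \<noteq> 0" using r v by (metis eq_iff_diff_eq_0 norm_minus_cancel norm_one order_less_irrefl)
    then show "norm (1 - r * v) > 0" by simp
    from sums_Re[OF Ln_series'[OF lt]]
    have "(\<lambda>n. Re (- (((r * v) ^ n)) / of_nat n)) sums Re (Ln (1 - r * v))" by simp
    then show "(\<lambda>n. - (r ^ n * Re (v ^ n) / real n)) sums ln (norm (1 - r * v))"
      using nz by (simp add: power_mult_distrib Re_divide_of_nat flip: of_real_power)
  qed
  have w2: "norm (w\<^sup>2) = 1" using w by (simp add: norm_power)
  have s: "(\<lambda>n. 3 * (- (r ^ n * Re (1 ^ n) / real n)) + 4 * (- (r ^ n * Re (w ^ n) / real n)) + (- (r ^ n * Re ((w\<^sup>2) ^ n) / real n)))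
      sums (3 * ln (norm (1 - r * (1::complex))) + 4 * ln (norm (1 - r * w)) + ln (norm (1 - r * w\<^sup>2)))"
    by (intro sums_add sums_mult ln_sums w w2) simp
  have "3 * (- (r ^ n * Re (1 ^ n) / real n)) + 4 * (- (r ^ n * Re (w ^ n) / real n)) + (- (r ^ n * Re ((w\<^sup>2) ^ n) / real n)) \<le> 0" for n
  proof -
    define v where "v = w ^ n"
    have "norm v = 1" using w by (simp add: v_def norm_power)
    then have "(Re v)\<^sup>2 + (Im v)\<^sup>2 = 1" by (metis cmod_power2 power_one)
    then have "Re (v\<^sup>2) = 2 * (Re v)\<^sup>2 - 1" by (simp add: Re_power2)
    moreover have "(w\<^sup>2) ^ n = v\<^sup>2" by (simp add: v_def mult.commute flip: power_mult)
    ultimately have "Re ((w\<^sup>2) ^ n) = 2 * (Re v)\<^sup>2 - 1" by simp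
    then have "3 * (- (r ^ n * Re (1 ^ n) / real n)) + 4 * (- (r ^ n * Re (w ^ n) / real n)) + (- (r ^ n * Re ((w\<^sup>2) ^ n) / real n))
        = - (r ^ n / real n * (2 * (1 + Re v)\<^sup>2))"
      by (simp only: v_def[symmetric] power_one one_complex.sel) (simp add: divide_inverse power2_eq_square algebra_simps)
    also have "\<dots> \<le> 0" using r by simp
    finally show ?thesis .
  qed
  then have le0: "3 * ln (norm (1 - r * (1::complex))) + 4 * ln (norm (1 - r * w)) + ln (norm (1 - r * w\<^sup>2)) \<le> 0"
    by (intro sums_le[OF _ s sums_zero])
  have r1: "norm (1 - r * (1::complex)) = 1 - r"
    using r by (metis abs_of_nonneg diff_ge_0_iff_ge less_imp_le mult.right_neutral norm_of_real of_real_1 of_real_diff)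
  have "ln ((1 - r) ^ 3 * norm (1 - r * w) ^ 4 * norm (1 - r * w\<^sup>2)) \<le> 0"
    using le0 r nz[OF w] nz[OF w2] unfolding r1 by (simp add: ln_mult ln_realpow)
  moreover have "(1 - r) ^ 3 * norm (1 - r * w) ^ 4 * norm (1 - r * w\<^sup>2) > 0"
    using r nz[OF w] nz[OF w2] by simp
  ultimately show ?thesis by (metis ln_le_zero_iff)
qed

text \<open>Working with sieved products avoids logarithms of zeta: the sieved values tend to 1,
  while the factors belonging to one prime multiply to at most 1 by
  \<open>norm_prod_341_le\<close>.\<close>

lemma zeta_341:
  assumes \<sigma>: "\<sigma> > 1"
  shows "norm (zeta (of_real \<sigma>)) ^ 3 * norm (zeta (Complex \<sigma> t)) ^ 4 * norm (zeta (Complex \<sigma> (2 * t))) \<ge> 1"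
proof -
  define E where "E N s = zeta s * (\<Prod>p | prime p \<and> p \<le> N. 1 - of_nat p powr (-s))" for N :: nat and s
  have lim: "(\<lambda>N. norm (E N (of_real \<sigma>)) ^ 3 * norm (E N (Complex \<sigma> t)) ^ 4 * norm (E N (Complex \<sigma> (2 * t))))
      \<longlonglongrightarrow> norm (1::complex) ^ 3 * norm (1::complex) ^ 4 * norm (1::complex)"
    unfolding E_def by (intro tendsto_intros euler_product_tendsto) (use \<sigma> in auto)
  have le: "norm (E N (of_real \<sigma>)) ^ 3 * norm (E N (Complex \<sigma> t)) ^ 4 * norm (E N (Complex \<sigma> (2 * t)))
      \<le> norm (zeta (of_real \<sigma>)) ^ 3 * norm (zeta (Complex \<sigma> t)) ^ 4 * norm (zeta (Complex \<sigma> (2 * t)))" (is "_ \<le> ?Z") for N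
  proof -
    let ?P = "{p. prime p \<and> p \<le> N}"
    have "norm (E N (of_real \<sigma>)) ^ 3 * norm (E N (Complex \<sigma> t)) ^ 4 * norm (E N (Complex \<sigma> (2 * t)))
      = ?Z * (\<Prod>p\<in>?P. norm (1 - of_nat p powr (- of_real \<sigma>) :: complex) ^ 3
          * norm (1 - of_nat p powr (- Complex \<sigma> t)) ^ 4 * norm (1 - of_nat p powr (- Complex \<sigma> (2 * t))))"
    proof -
      have E: "norm (E N s) = norm (zeta s) * (\<Prod>p\<in>?P. norm (1 - of_nat p powr (-s)))" for s
        unfolding E_def by (simp add: norm_mult prod_norm)
      show ?thesis
        unfolding E prod.distrib prod_power_distrib[symmetric] power_mult_distrib by (simp only: mult_ac)
    qed
    also have "\<dots> \<le> ?Z * 1"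
    proof (intro mult_left_mono prod_le_1 conjI)
      fix p assume "p \<in> ?P"
      then have p: "p > 1" by (auto simp: prime_gt_Suc_0_nat)
      define r where "r = real p powr (- \<sigma>)"
      define w where "w = of_nat p powr (- (\<i> * of_real t))"
      have r: "0 \<le> r" "r < 1"
        using p \<sigma> by (auto simp: r_def powr_less_one)
      have w: "norm w = 1" using p by (simp add: w_def norm_of_nat_powr)
      have 1: "(of_nat p :: complex) powr (- of_real \<sigma>) = of_real r"
        unfolding r_def using powr_of_real[of "real p" "-\<sigma>"] by simp
      have "- Complex \<sigma> t = - of_real \<sigma> + - (\<i> * of_real t)" by (simp add: complex_eq_iff)
      then have 2: "of_nat p powr (- Complex \<sigma> t) = r * w"
        by (simp only: powr_add 1 w_def)
      have "- Complex \<sigma> (2 * t) = - of_real \<sigma> + (- (\<i> * of_real t) + - (\<i> * of_real t))" by (simp add: complex_eq_iff)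
      then have 3: "of_nat p powr (- Complex \<sigma> (2 * t)) = r * w\<^sup>2"
        by (simp only: powr_add 1 w_def power2_eq_square)
      have 4: "norm (1 - of_real r :: complex) = 1 - r"
        using r by (metis abs_of_nonneg diff_ge_0_iff_ge less_imp_le norm_of_real of_real_1 of_real_diff)
      show "norm (1 - of_nat p powr (- of_real \<sigma>) :: complex) ^ 3
          * norm (1 - of_nat p powr (- Complex \<sigma> t)) ^ 4 * norm (1 - of_nat p powr (- Complex \<sigma> (2 * t))) \<le> 1"
        unfolding 1 2 3 4 by (rule norm_prod_341_le[OF r w])
    qed simp_all
    finally show ?thesis by simp
  qed
  have "norm (1::complex) ^ 3 * norm (1::complex) ^ 4 * norm (1::complex) \<le>
      norm (zeta (of_real \<sigma>)) ^ 3 * norm (zeta (Complex \<sigma> t)) ^ 4 * norm (zeta (Complex \<sigma> (2 * t)))"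
    by (rule LIMSEQ_le_const2[OF lim]) (use le in blast)
  then show ?thesis by simp
qed

section \<open>Growth of zeta and its derivative near the line Re s = 1\<close>

lemma powr_tenth_double:
  fixes \<tau> :: real
  assumes "\<tau> \<ge> 0"
  shows "(2 * \<tau>) powr (1/10) \<le> 2 * \<tau> powr (1/10)"
proof -
  have "(2 * \<tau>) powr (1/10) = 2 powr (1/10) * \<tau> powr (1/10)" using assms by (simp add: powr_mult)
  also have "\<dots> \<le> 2 powr 1 * \<tau> powr (1/10)" by (intro mult_right_mono powr_mono) auto
  finally show ?thesis by simp
qed

text \<open>With \<open>M\<close> of the size of \<open>\<bar>Im s\<bar> + 3\<close>, the factor
  \<open>norm s\<close> in the error is at most \<open>M\<close>, and \<open>Re s \<ge> 9/10\<close>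
  makes partial sum, boundary term and error multiples of \<open>M powr (1/10)\<close>. The distance
  from 1 serves to divide the boundary term by \<open>s - 1\<close>.\<close>

lemma norm_zeta_le:
  assumes s: "Re s \<in> {9/10..3}" and s1: "norm (s - 1) \<ge> 1/8"
  shows "norm (zeta s) \<le> 60 * (\<bar>Im s\<bar> + 3) powr (1/10)"
proof -
  define \<tau> where "\<tau> = \<bar>Im s\<bar> + 3"
  define M where "M = nat \<lceil>\<tau>\<rceil>"
  have \<tau>: "\<tau> \<ge> 3" by (simp add: \<tau>_def)
  have M: "\<tau> \<le> real M" "real M \<le> 2 * \<tau>" "M > 0" using \<tau> by (auto simp: M_def) linarith+
  define S where "S = (\<Sum>k<M. (of_nat (Suc k) :: complex) powr (-s))"
  define E where "E = zeta_reg s - ((s - 1) * S + of_nat (Suc M) powr (1 - s))"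
  have sne: "s - 1 \<noteq> 0" using s1 by auto
  have ns: "norm s \<le> real M" using cmod_le[of s] s M by (auto simp: \<tau>_def)
  have S: "norm S \<le> 11 * real M powr (1/10)"
  proof -
    have "norm S \<le> (\<Sum>k<M. real (Suc k) powr (1/10 - 1))"
      unfolding S_def using s by (intro sum_norm_le) (simp add: norm_of_nat_powr powr_mono del: of_nat_Suc)
    also have "\<dots> \<le> real M powr (1/10) * (1 / real M + 1 / (1/10))"
      by (rule powr_partial_sum) (use M in auto)
    also have "\<dots> \<le> real M powr (1/10) * 11"
      using M \<tau> by (intro mult_left_mono) auto
    finally show ?thesis by simp
  qed
  have b: "norm ((of_nat (Suc M) :: complex) powr (1 - s)) \<le> 2 * real M powr (1/10)"
  proof -
    have "norm ((of_nat (Suc M) :: complex) powr (1 - s)) \<le> real (Suc M) powr (1/10)"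
      using s by (simp add: norm_of_nat_powr powr_mono del: of_nat_Suc)
    also have "\<dots> \<le> (2 * real M) powr (1/10)" using M by (intro powr_mono2) auto
    also have "\<dots> \<le> 2 * real M powr (1/10)" by (rule powr_tenth_double) simp
    finally show ?thesis .
  qed
  have E: "norm E \<le> norm (s - 1) * (2 * real M powr (1/10))"
  proof -
    have "norm E \<le> norm (s - 1) * norm s * (real M powr (- Re s) / Re s)"
      unfolding E_def S_def by (rule zeta_reg_approx) (use s M in auto)
    also have "\<dots> = norm (s - 1) * (norm s * (real M powr (- Re s) / Re s))" by simp
    also have "norm s * (real M powr (- Re s) / Re s) \<le> real M * (real M powr (- Re s) / (1/2))"
      using ns s by (intro mult_mono divide_left_mono) auto
    also have "\<dots> = 2 * real M powr (1 - Re s)" using M by (simp add: powr_diff powr_minus field_simps)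
    also have "\<dots> \<le> 2 * real M powr (1/10)" using M s \<tau> by (intro mult_left_mono powr_mono) auto
    finally show ?thesis by (simp add: mult_left_mono)
  qed
  have "zeta s = S + of_nat (Suc M) powr (1 - s) / (s - 1) + E / (s - 1)"
    using sne by (simp add: zeta_def E_def add_divide_distrib diff_divide_distrib)
  also have "norm \<dots> \<le> norm S + norm ((of_nat (Suc M) :: complex) powr (1 - s)) / norm (s - 1) + norm E / norm (s - 1)"
    by (intro order_trans[OF norm_triangle_ineq] add_mono) (simp_all add: norm_divide)
  \<comment> \<open>The coefficients 11, 2 * 8 and 2 add up to 29; passing from \<open>M\<close> to
    \<open>\<tau>\<close> doubles this.\<close>
  also have "\<dots> \<le> 11 * real M powr (1/10) + (2 * real M powr (1/10)) / (1/8) + 2 * real M powr (1/10)"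
  proof (intro add_mono S frac_le b s1)
    show "norm E / norm (s - 1) \<le> 2 * real M powr (1/10)"
      using E sne by (simp add: divide_le_eq mult.commute)
  qed auto
  also have "\<dots> = 29 * real M powr (1/10)" by simp
  also have "real M powr (1/10) \<le> (2 * \<tau>) powr (1/10)" using M by (intro powr_mono2) auto
  also have "\<dots> \<le> 2 * \<tau> powr (1/10)" using \<tau> by (intro powr_tenth_double) auto
  finally have "norm (zeta s) \<le> 58 * \<tau> powr (1/10)" by simp
  also have "\<dots> \<le> 60 * \<tau> powr (1/10)" by (intro mult_right_mono) auto
  finally show ?thesis unfolding \<tau>_def .
qed

text \<open>Cauchy's inequality on a circle of radius 1/20, on which \<open>norm_zeta_le\<close>
  applies. The change of height costs at most a factor 2, and 20 * 120 = 2400.\<close>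

lemma norm_deriv_zeta_le:
  assumes s: "Re s \<in> {19/20..2}" and t: "\<bar>Im s\<bar> \<ge> 1/4"
  shows "norm (deriv zeta s) \<le> 2400 * (\<bar>Im s\<bar> + 3) powr (1/10)"
proof -
  have near: "Re w \<in> {9/10..3}" "\<bar>Im w\<bar> \<ge> 1/8" "\<bar>Im w\<bar> + 3 \<le> 2 * (\<bar>Im s\<bar> + 3)"
    if "norm (s - w) \<le> 1/20" for w
    using that abs_Re_le_cmod[of "s - w"] abs_Im_le_cmod[of "s - w"] s t by auto
  have hol: "zeta holomorphic_on cball s (1/20)"
  proof (rule holomorphic_on_subset[OF holomorphic_zeta])
    show "cball s (1/20) \<subseteq> {s. Re s > 0} - {1}"
      using near(1,2) by (force simp: dist_norm)
  qed
  have "norm ((deriv ^^ 1) zeta s) \<le> fact 1 * (120 * (\<bar>Im s\<bar> + 3) powr (1/10)) / (1/20) ^ 1"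
  proof (rule Cauchy_inequality)
    fix w assume "norm (s - w) = 1/20"
    then have w: "norm (s - w) \<le> 1/20" by simp
    have "norm (w - 1) \<ge> 1/8" using abs_Im_le_cmod[of "w - 1"] near(2)[OF w] by simp
    then have "norm (zeta w) \<le> 60 * (\<bar>Im w\<bar> + 3) powr (1/10)" by (rule norm_zeta_le[OF near(1)[OF w]])
    also have "\<dots> \<le> 60 * (2 * (\<bar>Im s\<bar> + 3)) powr (1/10)"
      using near(3)[OF w] by (intro mult_left_mono powr_mono2) auto
    also have "\<dots> \<le> 60 * (2 * (\<bar>Im s\<bar> + 3) powr (1/10))"
      by (intro mult_left_mono powr_tenth_double) auto
    finally show "norm (zeta w) \<le> 120 * (\<bar>Im s\<bar> + 3) powr (1/10)" by simp
  qed (use hol in \<open>auto intro: holomorphic_on_imp_continuous_on holomorphic_on_subset\<close>)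
  then show ?thesis by simp
qed

text \<open>
  The region \<open>\<bar>Re s - 1\<bar> \<le> zfr_const / sqrt (\<bar>Im s\<bar> + 3)\<close> is free of zeros. With \<open>a\<close> the
  width of this region and \<open>B = (\<bar>Im s\<bar> + 3) powr (1/10)\<close>, the constant is chosen such that the
  lower bound \<open>9600 * B * a\<close> for \<open>zeta\<close> at real part \<open>1 + a\<close> that follows from the 3-4-1
  inequality is twice the variation \<open>2400 * B * 2 * a\<close> of \<open>zeta\<close> across the region.
\<close>

definition zfr_const :: real where "zfr_const = 1 / (960 * 9600 ^ 4)"

section \<open>The zero-free region and lower bounds for zeta in it\<close>

lemma zfr_const: "zfr_const > 0" "zfr_const \<le> 1/1000" by (simp_all add: zfr_const_def)

lemma zfr_width:
  assumes T: "T \<ge> 1"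
  shows "0 < zfr_const / sqrt T" "zfr_const / sqrt T \<le> 1/1000"
proof -
  have "zfr_const / sqrt T \<le> zfr_const / 1" using T zfr_const by (intro divide_left_mono) auto
  then show "zfr_const / sqrt T \<le> 1/1000" using zfr_const(2) by linarith
  show "0 < zfr_const / sqrt T" using T zfr_const(1) by simp
qed

text \<open>The pole is simple: \<open>zeta_reg\<close> stays within distance 1 of its value 1 at
  \<open>s = 1\<close>.\<close>

lemma norm_zeta_real_le:
  assumes a: "0 < a" "a \<le> 1/3"
  shows "norm (zeta (of_real (1 + a))) \<le> 2 / a"
proof -
  let ?s = "of_real (1 + a) :: complex"
  have "norm (zeta_reg ?s - 1) \<le> norm (?s - 1) * norm ?s * (1 + 1 / Re ?s)"
    by (rule zeta_reg_near_1) (use a in auto)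
  also have "norm (?s - 1) = a" 
  proof -
    have "?s - 1 = of_real a" by simp
    then show ?thesis using a by (simp only: norm_of_real)
  qed
  also have "norm ?s = 1 + a" using a by (simp only: norm_of_real)
  also have "a * (1 + a) * (1 + 1 / Re ?s) = a * (2 + a)" using a by (simp add: field_simps)
  also have "\<dots> \<le> 1" using a mult_mono[of a "1/3" "2 + a" "7/3"] by simp
  finally have "norm (zeta_reg ?s) \<le> 2"
    using norm_triangle_ineq2[of "zeta_reg ?s" 1] by simp
  then show ?thesis using a by (simp add: zeta_def norm_divide divide_right_mono)
qed

lemma zeta_nonzero: "Re s > 1 \<Longrightarrow> zeta s \<noteq> 0"
  using zeta_341[of "Re s" "Im s"] by auto

text \<open>The 3-4-1 inequality bounds zeta from below at real part \<open>1 + a\<close>, just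
  right of the line, and the derivative bound carries this across the line, losing at most
  half.\<close>

lemma norm_zeta_ge:
  fixes \<sigma> t :: real
  defines "a \<equiv> zfr_const / sqrt (\<bar>t\<bar> + 3)"
  assumes t: "\<bar>t\<bar> \<ge> 1/4" and \<sigma>: "\<bar>\<sigma> - 1\<bar> \<le> a"
  shows "norm (zeta (Complex \<sigma> t)) \<ge> a"
proof -
  define \<tau> where "\<tau> = \<bar>t\<bar> + 3"
  define B where "B = \<tau> powr (1/10)"
  have \<tau>: "\<tau> \<ge> 3" by (simp add: \<tau>_def)
  have a: "0 < a" "a \<le> 1/1000" using zfr_width[of \<tau>] \<tau> by (auto simp: a_def \<tau>_def)
  have B1: "B \<ge> 1" using \<tau> by (simp add: B_def ge_one_powr_ge_zero)
  \<comment> \<open>Four factors \<open>9600 * B * a\<close> and one factor \<open>120 * B\<close>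
    will produce \<open>B ^ 5\<close>; the exponent 1/10 turns it into the square root that occurs
    in the width \<open>a\<close>.\<close>
  have B5: "B ^ 5 = sqrt \<tau>"
  proof -
    have "B ^ 5 = B powr real 5" using B1 by (subst powr_realpow) auto
    also have "\<dots> = \<tau> powr (1/2)" unfolding B_def powr_powr by simp
    finally show ?thesis using \<tau> by (simp add: powr_half_sqrt)
  qed
  have main: "norm (zeta (Complex (1 + a) t)) \<ge> 9600 * B * a"
  proof (rule ccontr)
    assume "\<not> ?thesis"
    then have lt: "norm (zeta (Complex (1 + a) t)) < 9600 * B * a" by simp
    have z2: "norm (zeta (Complex (1 + a) (2 * t))) \<le> 120 * B"
    proof -
      have "norm (zeta (Complex (1 + a) (2 * t))) \<le> 60 * (\<bar>Im (Complex (1 + a) (2 * t))\<bar> + 3) powr (1/10)"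
        using a t abs_Im_le_cmod[of "Complex (1 + a) (2 * t) - 1"] by (intro norm_zeta_le) auto
      also have "\<dots> \<le> 60 * (2 * \<tau>) powr (1/10)" by (intro mult_left_mono powr_mono2) (auto simp: \<tau>_def)
      also have "\<dots> \<le> 60 * (2 * B)" unfolding B_def using \<tau> by (intro mult_left_mono powr_tenth_double) auto
      finally show ?thesis by simp
    qed
    have "1 \<le> norm (zeta (of_real (1 + a))) ^ 3 * norm (zeta (Complex (1 + a) t)) ^ 4 * norm (zeta (Complex (1 + a) (2 * t)))"
      by (rule zeta_341) (use a in auto)
    also have "\<dots> \<le> (2 / a) ^ 3 * norm (zeta (Complex (1 + a) t)) ^ 4 * (120 * B)"
      using a B1 by (intro mult_mono power_mono norm_zeta_real_le z2) auto
    also have "\<dots> < (2 / a) ^ 3 * (9600 * B * a) ^ 4 * (120 * B)"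
      using a B1 lt by (intro mult_strict_right_mono mult_strict_left_mono power_strict_mono) auto
    \<comment> \<open>One power of \<open>a\<close> is left over, and \<open>zfr_const\<close> is
      the reciprocal of the numerical factor, so the chain ends in \<open>1 < 1\<close>.\<close>
    also have "\<dots> = 960 * 9600 ^ 4 * B ^ 5 * a"
    proof -
      have "(2 / a) ^ 3 * (c * B * a) ^ 4 * (d * B) = 8 * d * c ^ 4 * B ^ 5 * a" for c d :: real
        using a by (simp add: power_divide power_mult_distrib) (simp add: field_simps eval_nat_numeral)
      from this[of 9600 120] show ?thesis by simp
    qed
    also have "\<dots> = 960 * 9600 ^ 4 * zfr_const * (sqrt \<tau> / sqrt \<tau>)"
      unfolding B5 a_def \<tau>_def by (simp only: times_divide_eq_right times_divide_eq_left mult_ac)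
    also have "\<dots> = 1"
      using \<tau> by (simp add: zfr_const_def)
    finally show False by simp
  qed
  let ?S = "closed_segment (Complex (1 - a) t) (Complex (1 + a) t)"
  have S: "?S = {z. Im z = t \<and> Re z \<in> {1 - a..1 + a}}" using a by (intro closed_segment_horizontal) auto
  have "norm (zeta (Complex (1 + a) t) - zeta (Complex \<sigma> t)) \<le> 2400 * B * norm (Complex (1 + a) t - Complex \<sigma> t)"
  proof (rule field_differentiable_bound[of ?S])
    show "convex ?S" by (rule convex_closed_segment)
    show "Complex (1 + a) t \<in> ?S" "Complex \<sigma> t \<in> ?S" using a \<sigma> by (auto simp: S)
    fix z assume z: "z \<in> ?S"
    have "zeta field_differentiable at z"
    proof (rule holomorphic_on_imp_differentiable_at[OF holomorphic_zeta])
      show "open ({s. Re s > 0} - {1})" by (intro open_Diff open_halfspace_Re_gt) auto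
      show "z \<in> {s. Re s > 0} - {1}" using z a t by (auto simp: S)
    qed
    then show "(zeta has_field_derivative deriv zeta z) (at z within ?S)"
      by (rule has_field_derivative_at_within[OF field_differentiable_derivI])
    show "norm (deriv zeta z) \<le> 2400 * B"
      using norm_deriv_zeta_le[of z] z a t by (auto simp: S B_def \<tau>_def)
  qed
  also have "Complex (1 + a) t - Complex \<sigma> t = of_real (1 + a - \<sigma>)" by (simp add: complex_eq_iff)
  also have "norm (of_real (1 + a - \<sigma>) :: complex) = \<bar>1 + a - \<sigma>\<bar>" by (rule norm_of_real)
  also have "2400 * B * \<bar>1 + a - \<sigma>\<bar> \<le> 2400 * B * (2 * a)" using \<sigma> B1 by (intro mult_left_mono) auto
  finally have "norm (zeta (Complex \<sigma> t)) \<ge> 9600 * B * a - 4800 * B * a"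
    using main norm_triangle_ineq2[of "zeta (Complex (1 + a) t)" "zeta (Complex \<sigma> t)"] by linarith
  moreover have "9600 * B * a - 4800 * B * a \<ge> a"
    using B1 a by (simp add: mult_right_mono[of 1 "4800 * B" a, simplified] algebra_simps)
  ultimately show ?thesis by linarith
qed

text \<open>Near the real axis \<open>zeta_reg\<close> is close to 1; at larger heights
  \<open>norm_zeta_ge\<close> applies, and the width at height \<open>T\<close> is the smallest
  among all heights up to \<open>T\<close>. The quotient in the second claim is
  \<open>1 / zeta s\<close>.\<close>

lemma zeta_reg_nonzero:
  assumes T: "T \<ge> 0" and t: "\<bar>Im s\<bar> \<le> T" and re: "Re s \<ge> 1 - zfr_const / sqrt (T + 3)"
  shows "zeta_reg s \<noteq> 0"
    and "Re s \<le> 1 \<Longrightarrow> norm ((s - 1) / zeta_reg s) \<le> sqrt (T + 3) / zfr_const"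
proof -
  let ?a = "zfr_const / sqrt (T + 3)"
  have a: "0 < ?a" "?a \<le> 1/1000" using zfr_width[of "T + 3"] T by auto
  have small: "norm (zeta_reg s) \<ge> 1/3 \<and> norm (s - 1) \<le> 1/3" if "\<bar>Im s\<bar> \<le> 1/4" "Re s \<le> 1"
  proof -
    \<comment> \<open>The sum of 1/4 and 1/1000 is below 13/50; the three bounds are chosen so that
      their product stays below 2/3.\<close>
    have 1: "norm (s - 1) \<le> 13/50" using cmod_le[of "s - 1"] that re a by auto
    have 2: "norm s \<le> 63/50" using norm_triangle_ineq[of "s - 1" 1] 1 by simp
    have "1 / Re s \<le> 1 / (999/1000)" using re a by (intro frac_le) auto
    then have 3: "1 + 1 / Re s \<le> 202/100" by simp
    have "norm (zeta_reg s - 1) \<le> norm (s - 1) * norm s * (1 + 1 / Re s)"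
      by (rule zeta_reg_near_1) (use re a in auto)
    also have "\<dots> \<le> 13/50 * (63/50) * (202/100)"
      using 1 2 3 re a by (intro mult_mono) auto
    also have "\<dots> \<le> 2/3" by simp
    finally show ?thesis using norm_triangle_ineq2[of 1 "1 - zeta_reg s"] 1 by (auto simp: norm_minus_commute)
  qed
  have big: "norm (zeta s) \<ge> ?a" if "\<bar>Im s\<bar> \<ge> 1/4" "Re s \<le> 1"
  proof -
    have le: "?a \<le> zfr_const / sqrt (\<bar>Im s\<bar> + 3)"
      using t zfr_const by (intro divide_left_mono) auto
    have "zfr_const / sqrt (\<bar>Im s\<bar> + 3) \<le> norm (zeta (Complex (Re s) (Im s)))"
      by (rule norm_zeta_ge) (use that le re in auto)
    with le show ?thesis by simp
  qed
  show "zeta_reg s \<noteq> 0"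
  proof (cases "Re s \<le> 1")
    case True
    then show ?thesis using small big a by (cases "\<bar>Im s\<bar> \<le> 1/4") (auto simp: zeta_def)
  next
    case False
    then show ?thesis using zeta_nonzero[of s] by (auto simp: zeta_def)
  qed
  show "norm ((s - 1) / zeta_reg s) \<le> sqrt (T + 3) / zfr_const" if "Re s \<le> 1"
  proof (cases "\<bar>Im s\<bar> \<le> 1/4")
    case True
    have "norm ((s - 1) / zeta_reg s) = norm (s - 1) / norm (zeta_reg s)" by (rule norm_divide)
    also have "\<dots> \<le> (1/3) / (1/3)" using small[OF True that] by (intro frac_le) auto
    also have "\<dots> = 1" by simp
    also have "1 \<le> 1 / ?a" by (subst le_divide_eq_1_pos[OF a(1)]) (use a(2) in linarith)
    finally show ?thesis by simp
  next
    case False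
    then have "norm (zeta s) \<ge> ?a" using big that by auto
    then have "1 / norm (zeta s) \<le> 1 / ?a" using a by (intro frac_le) auto
    then show ?thesis by (simp add: zeta_def norm_divide)
  qed
qed

section \<open>The Moebius function\<close>

lemma prime_factors_prod_primes:
  fixes A :: "nat set"
  assumes "finite A" "\<And>p. p \<in> A \<Longrightarrow> prime p"
  shows "prime_factors (\<Prod>A) = A"
proof -
  have "prime_factors (\<Prod>A) = \<Union>((prime_factors \<circ> (\<lambda>p. p)) ` A)"
    using assms assms(2)[of 0] by (intro prime_factors_prod) auto
  also have "\<dots> = A" using assms by (auto simp: prime_factorization_prime)
  finally show ?thesis .
qed

lemma bij_betw_squarefree_divisors:
  fixes n :: nat
  assumes n: "n > 0"
  shows "bij_betw (\<lambda>A. \<Prod>A) (Pow (prime_factors n)) {d. d dvd n \<and> squarefree d}"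
proof (rule bij_betwI[where g = prime_factors])
  have pf: "finite A \<and> (\<forall>p\<in>A. prime p)" if "A \<subseteq> prime_factors n" for A
    using that finite_subset[OF that] by auto
  show "(\<lambda>A. \<Prod>A) \<in> Pow (prime_factors n) \<rightarrow> {d. d dvd n \<and> squarefree d}"
  proof (intro Pi_I CollectI conjI)
    fix A assume "A \<in> Pow (prime_factors n)"
    then have A: "A \<subseteq> prime_factors n" by simp
    have "(\<Prod>p\<in>A. p) dvd (\<Prod>p\<in>prime_factors n. p ^ multiplicity p n)"
      using A by (intro prod_dvd_prod_subset2) (auto simp: prime_factors_multiplicity[symmetric], auto simp: prime_factors_multiplicity)
    then show "\<Prod>A dvd n" using prime_factorization_nat[OF n] by simp
    show "squarefree (\<Prod>A)"
      using pf[OF A] by (intro squarefree_prod_coprime) (auto intro: primes_coprime squarefree_prime)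
  qed
  show "prime_factors \<in> {d. d dvd n \<and> squarefree d} \<rightarrow> Pow (prime_factors n)"
    using n by (auto intro: dvd_prime_factors[THEN subsetD])
  show "prime_factors (\<Prod>A) = A" if "A \<in> Pow (prime_factors n)" for A
    using pf[of A] that by (intro prime_factors_prod_primes) auto
  fix d assume d: "d \<in> {d. d dvd n \<and> squarefree d}"
  then have "d > 0" using n by (auto intro: Nat.gr0I)
  have "d = (\<Prod>p\<in>prime_factors d. p ^ multiplicity p d)" by (rule prime_factorization_nat[OF \<open>d > 0\<close>])
  also have "\<dots> = \<Prod>(prime_factors d)"
    using d \<open>d > 0\<close> by (intro prod.cong) (auto simp: squarefree_factorial_semiring')
  finally show "\<Prod>(prime_factors d) = d" by simp
qed

lemma sum_Pow_card:
  fixes h :: "nat \<Rightarrow> 'a :: comm_ring_1"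
  assumes "finite P"
  shows "(\<Sum>A\<in>Pow P. h (card A)) = (\<Sum>k\<le>card P. of_nat (card P choose k) * h k)"
proof -
  have "(\<Sum>A\<in>Pow P. h (card A)) = (\<Sum>k\<le>card P. \<Sum>A\<in>{A \<in> Pow P. card A = k}. h (card A))"
    using assms by (intro sum.group[symmetric]) (auto intro: card_mono)
  also have "\<dots> = (\<Sum>k\<le>card P. of_nat (card P choose k) * h k)"
    using assms by (intro sum.cong refl) (simp add: n_subsets)
  finally show ?thesis .
qed

text \<open>Only squarefree divisors contribute, and these are the products of subsets of the set of
  prime factors; grouping the subsets by size gives a binomial sum. Below, \<open>h\<close> is the
  constant 1 or \<open>int\<close>.\<close>

lemma sum_divisors_moebius_mu_weighted:
  assumes n: "n > 0"
  shows "(\<Sum>d | d dvd n. moebius_mu d * h (prime_omega d))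
    = (\<Sum>k\<le>prime_omega n. (-1) ^ k * h k * int (prime_omega n choose k))"
proof -
  have "(\<Sum>d | d dvd n. moebius_mu d * h (prime_omega d))
      = (\<Sum>d | d dvd n \<and> squarefree d. (-1) ^ card (prime_factors d) * h (card (prime_factors d)))"
    using n by (intro sum.mono_neutral_cong_right) (auto simp: moebius_mu_def prime_omega_def)
  also have "\<dots> = (\<Sum>A\<in>Pow (prime_factors n). (-1) ^ card (prime_factors (\<Prod>A)) * h (card (prime_factors (\<Prod>A))))"
    by (rule sum.reindex_bij_betw[OF bij_betw_squarefree_divisors[OF n], symmetric])
  also have "\<dots> = (\<Sum>A\<in>Pow (prime_factors n). (-1) ^ card A * h (card A))"
  proof (intro sum.cong refl)
    fix A assume "A \<in> Pow (prime_factors n)"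
    then have "prime_factors (\<Prod>A) = A"
      using finite_subset[of A "prime_factors n"] by (intro prime_factors_prod_primes) auto
    then show "(-1) ^ card (prime_factors (\<Prod>A)) * h (card (prime_factors (\<Prod>A))) = (-1) ^ card A * h (card A)"
      by simp
  qed
  also have "\<dots> = (\<Sum>k\<le>prime_omega n. (-1) ^ k * h k * int (prime_omega n choose k))"
    unfolding prime_omega_def by (subst sum_Pow_card) (auto simp: mult_ac)
  finally show ?thesis .
qed

lemma sum_divisors_moebius_mu:
  assumes n: "n > 0"
  shows "(\<Sum>d | d dvd n. moebius_mu d) = (if n = 1 then 1 else 0)"
proof -
  have "(\<Sum>d | d dvd n. moebius_mu d) = (\<Sum>k\<le>prime_omega n. (-1) ^ k * int (prime_omega n choose k))"
    using sum_divisors_moebius_mu_weighted[OF n, of "\<lambda>_. 1"] by simp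
  also have "\<dots> = (if n = 1 then 1 else 0)"
  proof (cases "n = 1")
    case False
    then obtain p where "prime p" "p dvd n" using prime_factor_nat by blast
    then have "p \<in> prime_factors n" using n by (auto simp: prime_factors_dvd)
    then have "prime_omega n > 0" by (auto simp: prime_omega_def card_gt_0_iff)
    then show ?thesis using choose_alternating_sum[of "prime_omega n", where 'a = int] False by simp
  qed (simp add: prime_omega_def)
  finally show ?thesis .
qed

lemma primepow_iff_prime_omega:
  assumes n: "n > 0"
  shows "primepow n \<longleftrightarrow> prime_omega n = 1"
proof
  assume "primepow n"
  then obtain p k where "prime p" "k > 0" "n = p ^ k" by (auto simp: primepow_def)
  then show "prime_omega n = 1" by (simp add: prime_omega_def prime_factorization_prime_power)
next
  assume "prime_omega n = 1"
  then obtain p where p: "prime_factors n = {p}" by (auto simp: prime_omega_def card_1_singleton_iff)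
  then have "n = p ^ multiplicity p n" using prime_factorization_nat[OF n] by simp
  moreover have "prime p" "multiplicity p n > 0" using p by (auto simp: prime_factors_multiplicity)
  ultimately show "primepow n" unfolding primepow_def by blast
qed

text \<open>The alternating sum of \<open>k * (m choose k)\<close> is the derivative of
  \<open>(1 - x) ^ m\<close> at \<open>x = 1\<close>, which is -1 for \<open>m = 1\<close> and 0
  otherwise.\<close>

lemma sum_divisors_moebius_mu_omega:
  assumes n: "n > 0"
  shows "(\<Sum>d | d dvd n. moebius_mu d * int (prime_omega d)) = (if primepow n then -1 else 0)"
proof -
  have "(\<Sum>d | d dvd n. moebius_mu d * int (prime_omega d))
      = (\<Sum>k\<le>prime_omega n. (-1) ^ k * int k * int (prime_omega n choose k))"
    by (rule sum_divisors_moebius_mu_weighted[OF n])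
  also have "\<dots> = (if primepow n then -1 else 0)"
    using choose_alternating_linear_sum[of "prime_omega n", where 'a = int] primepow_iff_prime_omega[OF n]
    by (cases "prime_omega n = 1") auto
  finally show ?thesis .
qed

section \<open>The Dirichlet series of the Moebius function\<close>

lemma norm_moebius_mu_le: "norm (of_int (moebius_mu n) :: 'a :: {real_normed_algebra_1}) \<le> 1"
  by (simp add: moebius_mu_def minus_one_power_iff)

text \<open>The product of the two absolutely convergent series is rearranged along
  \<open>n = a * b\<close>; the inner sum over divisors is 1 at \<open>n = 1\<close> and 0
  elsewhere, so the product is 1.\<close>

lemma moebius_has_sum:
  assumes s: "Re s > 1"
  shows "((\<lambda>n. of_int (moebius_mu n) * of_nat n powr (-s)) has_sum (1 / zeta s)) {n::nat. n > 0}"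
proof -
  let ?P = "{n::nat. n > 0}"
  let ?z = "\<lambda>n::nat. of_nat n powr (-s) :: complex"
  let ?m = "\<lambda>n::nat. of_int (moebius_mu n) * ?z n"
  have z: "(?z has_sum zeta s) ?P" by (rule has_sum_nat_powr[OF s])
  have az: "(\<lambda>n. norm (?z n)) summable_on ?P"
    using has_sum_imp_summable[OF z] by (simp add: summable_on_iff_abs_summable_on_complex)
  have am: "(\<lambda>n. norm (?m n)) summable_on ?P"
  proof (rule Infinite_Sum.abs_summable_on_comparison_test[OF az])
    fix n show "norm (?m n) \<le> norm (?z n)"
      unfolding norm_mult by (intro mult_left_le_one_le norm_moebius_mu_le) auto
  qed
  define M where "M = infsum ?m ?P"
  have m: "(?m has_sum M) ?P" unfolding M_def by (rule has_sum_infsum[OF abs_summable_summable[OF am]])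
  have prod: "((\<lambda>(a, b). ?m a * ?z b) has_sum (M * zeta s)) (?P \<times> ?P)"
  proof (rule has_sum_SigmaI)
    show "((\<lambda>y. case (x, y) of (a, b) \<Rightarrow> ?m a * ?z b) has_sum (?m x * zeta s)) ?P" for x
      using has_sum_cmult_right[OF z, of "?m x"] by simp
    show "((\<lambda>x. ?m x * zeta s) has_sum (M * zeta s)) ?P"
      by (rule has_sum_cmult_left[OF m])
    show "(\<lambda>(a, b). ?m a * ?z b) summable_on ?P \<times> ?P"
    proof (rule abs_summable_summable)
      have "(\<lambda>(a, b). norm (?m a) * norm (?z b)) summable_on ?P \<times> ?P"
      proof (rule summable_on_SigmaI)
        show "((\<lambda>y. case (x, y) of (a, b) \<Rightarrow> norm (?m a) * norm (?z b)) has_sum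
            (norm (?m x) * infsum (\<lambda>n. norm (?z n)) ?P)) ?P" for x
          unfolding case_prod_conv by (rule has_sum_cmult_right[OF has_sum_infsum[OF az]])
        show "(\<lambda>x. norm (?m x) * infsum (\<lambda>n. norm (?z n)) ?P) summable_on ?P"
          by (rule summable_on_cmult_left[OF am])
      qed auto
      then show "(\<lambda>x. norm (case x of (a, b) \<Rightarrow> ?m a * ?z b)) summable_on ?P \<times> ?P"
        by (simp add: case_prod_unfold norm_mult)
    qed
  qed
  let ?D = "\<lambda>n::nat. {d. d dvd n}"
  have bij: "bij_betw (\<lambda>(n, d). (d, n div d)) (Sigma ?P ?D) (?P \<times> ?P)"
  proof (rule bij_betwI[where g = "\<lambda>(a, b). (a * b, a)"])
    show "(\<lambda>(n, d). (d, n div d)) \<in> Sigma ?P ?D \<rightarrow> ?P \<times> ?P"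
      by (auto simp: div_greater_zero_iff dvd_imp_le intro: dvd_pos_nat)
  qed auto
  have "((\<lambda>(n, d). ?m d * ?z (n div d)) has_sum (M * zeta s)) (Sigma ?P ?D)"
    using has_sum_reindex_bij_betw[OF bij, of "\<lambda>(a, b). ?m a * ?z b" "M * zeta s"] prod
    by (simp add: case_prod_unfold)
  then have "((\<lambda>n. if n = 1 then 1 else 0 :: complex) has_sum (M * zeta s)) ?P"
  proof (rule has_sum_SigmaD)
    fix n assume n: "n \<in> ?P"
    have "((\<lambda>d. ?m d * ?z (n div d)) has_sum (\<Sum>d | d dvd n. ?m d * ?z (n div d))) (?D n)"
      using n by (intro has_sum_finite) auto
    also have "(\<Sum>d | d dvd n. ?m d * ?z (n div d)) = (\<Sum>d | d dvd n. of_int (moebius_mu d) * ?z n)"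
    proof (intro sum.cong refl)
      fix d assume "d \<in> ?D n"
      then have "?z d * ?z (n div d) = ?z n" by (subst of_nat_mult_powr[symmetric]) (auto simp del: of_nat_mult)
      then show "?m d * ?z (n div d) = of_int (moebius_mu d) * ?z n" by (simp add: mult.assoc)
    qed
    also have "\<dots> = of_int (\<Sum>d | d dvd n. moebius_mu d) * ?z n"
      by (simp add: sum_distrib_right)
    also have "\<dots> = (if n = 1 then 1 else 0)"
      using n by (subst sum_divisors_moebius_mu) auto
    finally show "((\<lambda>y. case (n, y) of (n, d) \<Rightarrow> ?m d * ?z (n div d)) has_sum (if n = 1 then 1 else 0)) (?D n)"
      by simp
  qed
  moreover have "((\<lambda>n. if n = 1 then 1 else 0 :: complex) has_sum 1) ?P"
    by (rule has_sum_cong_neutral[THEN iffD1, OF _ _ _ has_sum_finite[of "{1::nat}" "\<lambda>_. 1", simplified]]) auto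
  ultimately have "M * zeta s = 1" by (rule has_sum_unique)
  then have "M = 1 / zeta s" using zeta_nonzero[OF s] by (simp add: field_simps)
  with m show ?thesis by simp
qed

lemma moebius_sums:
  assumes s: "Re s > 1"
  shows "(\<lambda>n. of_int (moebius_mu (Suc n)) * of_nat (Suc n) powr (-s)) sums (1 / zeta s)"
proof -
  have "{n::nat. n > 0} = Suc ` UNIV" by (auto simp: image_def gr0_conv_Suc)
  with moebius_has_sum[OF s]
  have "((\<lambda>n. of_int (moebius_mu n) * of_nat n powr (-s)) has_sum (1 / zeta s)) (Suc ` UNIV)" by simp
  then have "((\<lambda>n. of_int (moebius_mu (Suc n)) * of_nat (Suc n) powr (-s)) has_sum (1 / zeta s)) UNIV"
    by (subst (asm) has_sum_reindex) (auto simp: o_def)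
  then show ?thesis by (rule has_sum_imp_sums)
qed

section \<open>The bound for the partial sums of \<open>\<mu>(n) / n\<close>\<close>

definition moebius_harm :: "nat \<Rightarrow> real" where
  "moebius_harm N = (\<Sum>n=1..N. of_int (moebius_mu n) / real n)"

text \<open>A crude bound for the finitely many \<open>N\<close> below the asymptotic range.\<close>

lemma abs_moebius_harm_le: "\<bar>moebius_harm N\<bar> \<le> real N"
proof -
  have "\<bar>moebius_harm N\<bar> \<le> (\<Sum>n=1..N. \<bar>of_int (moebius_mu n) / real n\<bar>)"
    unfolding moebius_harm_def by (rule sum_abs)
  also have "\<dots> \<le> (\<Sum>n=1..N. 1)"
  proof (rule sum_mono)
    fix n assume "n \<in> {1..N}"
    then show "\<bar>of_int (moebius_mu n) / real n\<bar> \<le> 1"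
      using norm_moebius_mu_le[of n, where 'a = real] by (simp add: divide_le_eq)
  qed
  finally show ?thesis by simp
qed

text \<open>This is \<open>newman_estimate\<close> for \<open>1 / zeta (1 + z)\<close>, whose value
  at 0 is 0 because of the pole, so that the partial sum itself is bounded.
  \<open>zeta_reg_nonzero\<close> supplies the bound on the left of the imaginary axis.\<close>

lemma abs_moebius_harm_le_newman:
  fixes N :: nat
  defines "R \<equiv> ln (real N)"
  defines "d \<equiv> zfr_const / (2 * sqrt (R + 4))"
  assumes R: "R \<ge> 1"
  shows "\<bar>moebius_harm N\<bar> \<le> 6 / R + sqrt (R + 4) / zfr_const * d\<^sup>2 / R\<^sup>2
           + sqrt (R + 4) / zfr_const * R * exp (- d * R) / d"
proof -
  have N: "N \<ge> 1" using R unfolding R_def by (cases N) auto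
  \<comment> \<open>Dividing by \<open>zeta_reg\<close> fills in the removable singularity at 0 with
    the value 0.\<close>
  define f where "f z = z / zeta_reg (1 + z)" for z
  \<comment> \<open>The zero-free width at height \<open>R + 1\<close>, whence \<open>R + 4\<close>.
    As \<open>d\<close> is half of it, the closed rectangle fits into the open region
    \<open>S\<close>.\<close>
  define b where "b = zfr_const / sqrt (R + 4)"
  define S where "S = {z. Re z > - b} \<inter> {z. Im z < R + 1} \<inter> {z. Im z > - (R + 1)}"
  have b: "0 < b" "b \<le> 1/1000" using zfr_width[of "R + 4"] R by (auto simp: b_def)
  have d: "0 < d" "d < b" using zfr_const R by (auto simp: d_def b_def field_simps)
  have S: "open S" "convex S" unfolding S_def
    by (intro open_Int open_halfspace_Re_gt open_halfspace_Im_lt open_halfspace_Im_gt)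
       (intro convex_Int convex_halfspace_Re_gt convex_halfspace_Im_lt convex_halfspace_Im_gt)
  have R4: "(R + 1) + 3 = R + 4" by simp
  note zr = zeta_reg_nonzero[of "R + 1", unfolded R4, folded b_def]
  have nz: "zeta_reg (1 + z) \<noteq> 0" if "z \<in> S" for z
    by (rule zr) (use that R in \<open>auto simp: S_def\<close>)
  have "norm (f 0 - (\<Sum>n<N. of_int (moebius_mu (Suc n)) / of_nat (Suc n)))
      \<le> 6 / R + sqrt (R + 4) / zfr_const * d\<^sup>2 / R\<^sup>2 + sqrt (R + 4) / zfr_const * R * real N powr (- d) / d"
  proof (rule newman_estimate[OF norm_moebius_mu_le N R _ d(1) _ _ S])
    show "R \<le> real N" unfolding R_def using ln_le_minus_one[of "real N"] N by simp
    show "d \<le> R" using d b R by simp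
    show "sqrt (R + 4) / zfr_const \<ge> 0" using zfr_const R by simp
    show "cbox (Complex (-d) (-R)) (Complex R R) \<subseteq> S"
      using d by (auto simp: S_def in_cbox_complex_iff)
    show "f holomorphic_on S"
      unfolding f_def
    proof (intro holomorphic_intros nz)
      have "(zeta_reg \<circ> (\<lambda>z. 1 + z)) holomorphic_on S"
        by (intro holomorphic_on_compose_gen[OF _ holomorphic_zeta_reg] holomorphic_intros)
           (use b in \<open>auto simp: S_def\<close>)
      then show "(\<lambda>z. zeta_reg (1 + z)) holomorphic_on S" by (simp add: o_def)
    qed
    show "(\<lambda>n. of_int (moebius_mu (Suc n)) * of_nat (Suc n) powr (-1 - z)) sums f z" if "Re z > 0" for z
      using moebius_sums[of "1 + z"] that by (simp add: f_def zeta_def)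
    show "norm (f z) \<le> sqrt (R + 4) / zfr_const" if z: "Re z \<in> {-d..0}" "Im z \<in> {-R..R}" for z
      using zr(2)[of "1 + z"] z d R by (auto simp: f_def)
  qed
  moreover have "(\<Sum>n<N. of_int (moebius_mu (Suc n)) / of_nat (Suc n)) = (of_real (moebius_harm N) :: complex)"
    unfolding moebius_harm_def
    by (simp add: sum.atLeast1_atMost_eq)
  moreover have "real N powr (- d) = exp (- d * R)" using N by (simp add: powr_def R_def)
  ultimately show ?thesis by (simp add: f_def)
qed

lemma moebius_harm_bound:
  obtains C where "C > 0" "\<And>N. N \<ge> 1 \<Longrightarrow> \<bar>moebius_harm N\<bar> \<le> C / (1 + ln (real N))"
proof -
  define k where "k = zfr_const"
  have k: "k > 0" using zfr_const by (simp add: k_def)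
  define g where "g R = 6 / R + sqrt (R + 4) / k * (k / (2 * sqrt (R + 4)))\<^sup>2 / R\<^sup>2
           + sqrt (R + 4) / k * R * exp (- (k / (2 * sqrt (R + 4))) * R) / (k / (2 * sqrt (R + 4)))" for R :: real
  \<comment> \<open>The middle term has order \<open>R powr (-5/2)\<close>; the last is a polynomial
    in \<open>R\<close> times the exponential of a negative quantity of order \<open>sqrt R\<close>.
    So \<open>6 / R\<close> dominates.\<close>
  have "g \<in> O(\<lambda>R. 1 / (1 + R))" unfolding g_def using k by real_asymp
  then obtain c where c: "c > 0" "eventually (\<lambda>R. norm (g R) \<le> c * norm (1 / (1 + R))) at_top"
    by (elim landau_o.bigE)
  from c(2) obtain R0 where R0: "\<And>R. R \<ge> R0 \<Longrightarrow> norm (g R) \<le> c * norm (1 / (1 + R))"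
    by (auto simp: eventually_at_top_linorder)
  define R1 where "R1 = max 1 R0"
  \<comment> \<open>The second entry covers \<open>ln N < R1\<close> by the crude bound.\<close>
  define C where "C = max c (exp R1 * (1 + R1))"
  show thesis
  proof (rule that)
    show "C > 0" using c by (simp add: C_def)
    fix N :: nat assume N: "N \<ge> 1"
    have l0: "ln (real N) \<ge> 0" using N by simp
    show "\<bar>moebius_harm N\<bar> \<le> C / (1 + ln (real N))"
    proof (cases "ln (real N) \<ge> R1")
      case True
      then have "\<bar>moebius_harm N\<bar> \<le> g (ln (real N))"
        using abs_moebius_harm_le_newman[of N] by (simp add: g_def k_def R1_def)
      also have "\<dots> \<le> c * norm (1 / (1 + ln (real N)))" using R0[of "ln (real N)"] True by (auto simp: R1_def)
      also have "\<dots> = c / (1 + ln (real N))" using l0 by simp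
      also have "\<dots> \<le> C / (1 + ln (real N))" using l0 by (intro divide_right_mono) (auto simp: C_def)
      finally show ?thesis .
    next
      case False
      have "\<bar>moebius_harm N\<bar> \<le> real N" by (rule abs_moebius_harm_le)
      also have "real N = exp (ln (real N))" using N by simp
      also have "\<dots> * (1 + ln (real N)) \<le> exp R1 * (1 + R1)"
        using False l0 by (intro mult_mono) auto
      then have "exp (ln (real N)) \<le> exp R1 * (1 + R1) / (1 + ln (real N))"
        using l0 by (simp add: le_divide_eq)
      also have "\<dots> \<le> C / (1 + ln (real N))" using l0 by (intro divide_right_mono) (auto simp: C_def)
      finally show ?thesis .
    qed
  qed
qed

section \<open>Divisor sums and prime powers\<close>

lemma sum_divisors_swap:
  fixes h :: "nat \<Rightarrow> nat \<Rightarrow> 'a :: comm_monoid_add"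
  shows "(\<Sum>n=1..N. \<Sum>d | d dvd n. h d (n div d)) = (\<Sum>d=1..N. \<Sum>e=1..N div d. h d e)"
proof -
  have "(\<Sum>n=1..N. \<Sum>d | d dvd n. h d (n div d)) = (\<Sum>(n, d)\<in>Sigma {1..N} (\<lambda>n. {d. d dvd n}). h d (n div d))"
    by (rule sum.Sigma) auto
  also have "\<dots> = (\<Sum>(d, e)\<in>Sigma {1..N} (\<lambda>d. {1..N div d}). h d e)"
  proof (rule sum.reindex_bij_witness[where i = "\<lambda>(d, e). (d * e, d)" and j = "\<lambda>(n, d). (d, n div d)"])
    fix a assume "a \<in> Sigma {1..N} (\<lambda>n. {d. d dvd n})"
    then obtain n d where a: "a = (n, d)" "1 \<le> n" "n \<le> N" "d dvd n" by auto
    then have d: "1 \<le> d" "d \<le> n" by (auto intro: dvd_imp_le Suc_leI dvd_pos_nat)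
    then have "1 \<le> n div d" by (simp add: Suc_le_eq div_greater_zero_iff)
    moreover have "n div d \<le> N div d" using a by (intro div_le_mono)
    ultimately show "(case a of (n, d) \<Rightarrow> (d, n div d)) \<in> Sigma {1..N} (\<lambda>d. {1..N div d})" using a d by auto
    show "(case case a of (n, d) \<Rightarrow> (d, n div d) of (d, e) \<Rightarrow> (d * e, d)) = a" using a by simp
    show "(case case a of (n, d) \<Rightarrow> (d, n div d) of (d, e) \<Rightarrow> h d e) = (case a of (n, d) \<Rightarrow> h d (n div d))"
      using a by simp
  next
    fix b assume "b \<in> Sigma {1..N} (\<lambda>d. {1..N div d})"
    then obtain d e where b: "b = (d, e)" "1 \<le> d" "d \<le> N" "1 \<le> e" "e \<le> N div d" by auto
    then have "d * e \<le> N" by (metis less_eq_div_iff_mult_less_eq mult.commute Suc_le_eq One_nat_def)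
    then show "(case b of (d, e) \<Rightarrow> (d * e, d)) \<in> Sigma {1..N} (\<lambda>n. {d. d dvd n})" using b by auto
    show "(case case b of (d, e) \<Rightarrow> (d * e, d) of (n, d) \<Rightarrow> (d, n div d)) = b" using b by simp
  qed
  also have "\<dots> = (\<Sum>d=1..N. \<Sum>e=1..N div d. h d e)"
    by (rule sum.Sigma[symmetric]) auto
  finally show ?thesis .
qed

text \<open>Substituting \<open>q = d * c\<close> gives a double sum whose inner sum runs over the
  divisors of \<open>n div d\<close>; it is a divisor sum of \<open>moebius_mu\<close> and vanishes
  unless \<open>d = n\<close>.\<close>

lemma moebius_inversion:
  fixes h :: "nat \<Rightarrow> int"
  assumes n: "n > 0"
  shows "(\<Sum>q | q dvd n. (\<Sum>d | d dvd q. h d) * moebius_mu (n div q)) = h n"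
proof -
  have fin: "finite {d. d dvd m}" if "m > 0" for m :: nat using that by auto
  have flip: "(\<Sum>c | c dvd m. moebius_mu (m div c)) = (if m = 1 then 1 else 0)" if m: "m > 0" for m
  proof -
    have "(\<Sum>c | c dvd m. moebius_mu (m div c)) = (\<Sum>c | c dvd m. moebius_mu c)"
      by (rule sum.reindex_bij_witness[where i = "\<lambda>c. m div c" and j = "\<lambda>c. m div c"])
         (use m in \<open>auto simp: div_dvd_iff_mult dvd_div_eq_mult\<close>)
    then show ?thesis using sum_divisors_moebius_mu[OF m] by simp
  qed
  have "(\<Sum>q | q dvd n. (\<Sum>d | d dvd q. h d) * moebius_mu (n div q))
      = (\<Sum>q | q dvd n. \<Sum>d | d dvd q. h d * moebius_mu (n div q))"
    by (simp add: sum_distrib_right)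
  also have "\<dots> = (\<Sum>(q, d)\<in>Sigma {q. q dvd n} (\<lambda>q. {d. d dvd q}). h d * moebius_mu (n div q))"
    by (rule sum.Sigma) (use n in \<open>auto intro: dvd_pos_nat\<close>)
  also have "\<dots> = (\<Sum>(d, c)\<in>Sigma {d. d dvd n} (\<lambda>d. {c. c dvd n div d}). h d * moebius_mu (n div d div c))"
  proof (rule sum.reindex_bij_witness[where i = "\<lambda>(d, c). (d * c, d)" and j = "\<lambda>(q, d). (d, q div d)"])
    fix a assume "a \<in> Sigma {q. q dvd n} (\<lambda>q. {d. d dvd q})"
    then obtain q d where a: "a = (q, d)" "q dvd n" "d dvd q" by auto
    then have "d dvd n" "q div d dvd n div d" by (auto intro: dvd_trans div_dvd_div[THEN iffD2])
    then show "(case a of (q, d) \<Rightarrow> (d, q div d)) \<in> Sigma {d. d dvd n} (\<lambda>d. {c. c dvd n div d})" using a by auto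
    show "(case case a of (q, d) \<Rightarrow> (d, q div d) of (d, c) \<Rightarrow> (d * c, d)) = a" using a by simp
    show "(case case a of (q, d) \<Rightarrow> (d, q div d) of (d, c) \<Rightarrow> h d * moebius_mu (n div d div c))
        = (case a of (q, d) \<Rightarrow> h d * moebius_mu (n div q))" using a by (simp flip: div_mult2_eq)
  next
    fix b assume "b \<in> Sigma {d. d dvd n} (\<lambda>d. {c. c dvd n div d})"
    then obtain d c where b: "b = (d, c)" "d dvd n" "c dvd n div d" by auto
    have "d > 0" using b n by (auto intro: dvd_pos_nat)
    have "d * c dvd d * (n div d)" using b by (intro mult_dvd_mono) auto
    then have "d * c dvd n" using b by simp
    then show "(case b of (d, c) \<Rightarrow> (d * c, d)) \<in> Sigma {q. q dvd n} (\<lambda>q. {d. d dvd q})" using b by auto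
    show "(case case b of (d, c) \<Rightarrow> (d * c, d) of (q, d) \<Rightarrow> (d, q div d)) = b" using b \<open>d > 0\<close> by simp
  qed
  also have "\<dots> = (\<Sum>d | d dvd n. \<Sum>c | c dvd n div d. h d * moebius_mu (n div d div c))"
    by (rule sum.Sigma[symmetric]) (use n in \<open>auto simp: dvd_div_eq_0_iff intro!: fin Nat.gr0I\<close>)
  also have "\<dots> = (\<Sum>d | d dvd n. if d = n then h n else 0)"
  proof (intro sum.cong refl)
    fix d assume d: "d \<in> {d. d dvd n}"
    then have pos: "n div d > 0" using n by (auto simp: dvd_div_eq_0_iff intro!: Nat.gr0I)
    have "n div d = 1 \<longleftrightarrow> d = n" using d n by (auto simp: dvd_div_eq_mult)
    then show "(\<Sum>c | c dvd n div d. h d * moebius_mu (n div d div c)) = (if d = n then h n else 0)"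
      using flip[OF pos] by (auto simp flip: sum_distrib_left)
  qed
  also have "\<dots> = h n" using n by simp
  finally show ?thesis .
qed

section \<open>Chebyshev's bound and the number of prime powers\<close>

definition chebyshev_psi :: "nat \<Rightarrow> real" where
  "chebyshev_psi N = (\<Sum>n=1..N. mangoldt n)"

text \<open>Summing \<open>ln n = (\<Sum>d | d dvd n. mangoldt d)\<close> over \<open>n\<close>,
  each \<open>d\<close> is counted once for every multiple up to \<open>N\<close>.\<close>

lemma ln_fact_conv_mangoldt: "ln (fact N) = (\<Sum>d=1..N. mangoldt d * real (N div d))"
proof -
  have "ln (fact N :: real) = (\<Sum>n=1..N. ln (real n))"
    unfolding fact_prod of_nat_prod by (subst ln_prod) auto
  also have "\<dots> = (\<Sum>n=1..N. \<Sum>d | d dvd n. mangoldt d)"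
    by (intro sum.cong refl) (simp add: mangoldt_sum)
  also have "\<dots> = (\<Sum>d=1..N. \<Sum>e=1..N div d. mangoldt d)"
    by (rule sum_divisors_swap)
  finally show ?thesis by (simp add: mult.commute)
qed

text \<open>
  In \<open>ln (2n choose n) = (\<Sum>d\<le>2n. mangoldt d * (2n div d - 2 * (n div d)))\<close> every summand is
  nonnegative, and those with \<open>d > n\<close> have weight 1.
\<close>

lemma chebyshev_psi_double: "chebyshev_psi (2 * n) - chebyshev_psi n \<le> 2 * real n * ln 2"
proof -
  have ext: "(\<Sum>d=1..n. mangoldt d * real (n div d)) = (\<Sum>d=1..2*n. mangoldt d * real (n div d))"
    by (rule sum.mono_neutral_left) auto
  have "chebyshev_psi (2 * n) - chebyshev_psi n = (\<Sum>d\<in>{1..2*n} - {1..n}. mangoldt d)"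
    unfolding chebyshev_psi_def by (subst sum_diff) auto
  also have "\<dots> = (\<Sum>d\<in>{1..2*n}. if d > n then mangoldt d else 0)"
    by (intro sum.mono_neutral_cong_left) auto
  also have "\<dots> \<le> (\<Sum>d=1..2*n. mangoldt d * (real (2 * n div d) - 2 * real (n div d)))"
  proof (rule sum_mono)
    fix d assume d: "d \<in> {1..2*n}"
    show "(if d > n then mangoldt d else 0) \<le> mangoldt d * (real (2 * n div d) - 2 * real (n div d))"
    proof (cases "d > n")
      case True
      then have "2 * n div d = 1" using d by (intro div_nat_eqI) auto
      then show ?thesis using True by simp
    next
      case False
      have "2 * (n div d) \<le> 2 * n div d"
      proof -
        have "2 * (n div d) * d \<le> 2 * n" by (simp add: mult.assoc)
        moreover have "d > 0" using d by simp
        ultimately show ?thesis by (simp add: less_eq_div_iff_mult_less_eq)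
      qed
      then have "real (2 * n div d) - 2 * real (n div d) \<ge> 0" by linarith
      then show ?thesis using False mangoldt_nonneg[of d] by simp
    qed
  qed
  also have "\<dots> = ln (fact (2 * n)) - 2 * ln (fact n)"
    unfolding ln_fact_conv_mangoldt ext by (simp add: right_diff_distrib sum_subtractf sum_distrib_left mult_ac)
  also have "\<dots> = ln (real ((2 * n) choose n))"
  proof -
    have "real ((2 * n) choose n) = fact (2 * n) / (fact n * fact n)"
      using binomial_fact[of n "2 * n", where 'a = real] by simp
    then show ?thesis by (simp only:) (subst ln_div; simp add: ln_mult)
  qed
  also have "\<dots> \<le> ln (2 ^ (2 * n))"
  proof (subst ln_le_cancel_iff)
    have "(2 * n) choose n \<le> (\<Sum>k\<le>2*n. (2 * n) choose k)" by (rule member_le_sum) auto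
    also have "\<dots> = 2 ^ (2 * n)" by (rule choose_row_sum)
    finally show "real ((2 * n) choose n) \<le> 2 ^ (2 * n)" by (metis of_nat_le_iff of_nat_numeral of_nat_power)
  qed (auto simp: zero_less_binomial_iff)
  also have "\<dots> = 2 * real n * ln 2" by (simp add: ln_realpow)
  finally show ?thesis .
qed

text \<open>The doubling bound adds up geometrically along powers of two; rounding \<open>N\<close>
  up to a power of two costs another factor 2, and \<open>ln 2 < 1\<close>.\<close>

lemma chebyshev_psi_le: "chebyshev_psi N \<le> 4 * real N"
proof (cases "N = 0")
  case False
  have pow: "chebyshev_psi (2 ^ k) \<le> 2 ^ Suc k * ln 2" for k
  proof (induction k)
    case 0
    then show ?case by (simp add: chebyshev_psi_def)
  next
    case (Suc k)
    then show ?case using chebyshev_psi_double[of "2 ^ k"] by simp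
  qed
  define L where "L = floor_log N"
  have "N \<le> 2 ^ Suc L" using floor_log_exp2_ge[of N] by (simp add: L_def)
  then have "chebyshev_psi N \<le> chebyshev_psi (2 ^ Suc L)"
    unfolding chebyshev_psi_def by (intro sum_mono2) (auto intro: mangoldt_nonneg)
  also have "\<dots> \<le> 2 ^ Suc (Suc L) * ln 2" by (rule pow)
  also have "\<dots> \<le> 2 ^ Suc (Suc L) * 1" using ln_2_less_1 by (intro mult_left_mono) auto
  also have "\<dots> = 4 * real (2 ^ L)" by simp
  also have "\<dots> \<le> 4 * real N"
    using floor_log_exp2_le[of N] False unfolding L_def by (intro mult_left_mono of_nat_mono) auto
  finally show ?thesis .
qed (simp add: chebyshev_psi_def)

lemma floor_log_bounds:
  assumes "n \<ge> 1"
  shows "real (floor_log n) * ln 2 \<le> ln (real n)" "ln (real n) \<le> (real (floor_log n) + 1) * ln 2"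
proof -
  let ?L = "floor_log n"
  have "2 ^ ?L \<le> n" using assms floor_log_exp2_le[of n] by simp
  then have "real (2 ^ ?L) \<le> real n" by (rule of_nat_mono)
  then have "ln (2 ^ ?L) \<le> ln (real n)" by (subst ln_le_cancel_iff) (use assms in auto)
  then show "real ?L * ln 2 \<le> ln (real n)" by (simp add: ln_realpow)
  have "n \<le> 2 ^ Suc ?L" using floor_log_exp2_ge[of n] by simp
  then have "real n \<le> real (2 ^ Suc ?L)" by (rule of_nat_mono)
  then have "ln (real n) \<le> ln (2 ^ Suc ?L)" by (subst ln_le_cancel_iff) (use assms in auto)
  then show "ln (real n) \<le> (real ?L + 1) * ln 2" by (simp add: ln_mult ln_realpow algebra_simps)
qed

definition primepow_count :: "nat \<Rightarrow> nat" where
  "primepow_count N = card {q \<in> {1..N}. primepow q}"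

text \<open>Prime powers are split by whether their prime \<open>p\<close> satisfies
  \<open>p\<^sup>2 \<le> N\<close>. If so, there are at most \<open>sqrt N\<close> primes and
  \<open>floor_log N\<close> exponents; if not, each has weight at least \<open>ln N / 2\<close> in
  \<open>chebyshev_psi N\<close>, which is at most \<open>4 * N\<close>.\<close>

lemma primepow_count_le:
  assumes N: "N \<ge> 1"
  shows "real (primepow_count N) \<le> 60 * real N / (1 + real (floor_log N))"
proof (cases "N = 1")
  case True
  then have "{q \<in> {1..N}. primepow q} = {}" by auto
  then show ?thesis using True by (simp only: primepow_count_def) simp
next
  case False
  define L where "L = floor_log N"
  define l where "l = ln (real N)"
  have l: "real L * ln 2 \<le> l" using floor_log_bounds[OF N] by (simp add: L_def l_def)
  have l2: "l \<ge> ln 2" using N False by (simp add: l_def)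
  have ln2: "ln 2 \<ge> (2/3 :: real)" by (rule ln2_ge_two_thirds)
  have L1: "2 * real L \<le> 3 * l" using l mult_left_mono[OF ln2, of "real L"] by simp
  have L2: "1 + real L \<le> 3 * l" using L1 l2 ln2 by simp
  have lpos: "l > 0" using l2 ln2 by linarith
  let ?A = "{q \<in> {1..N}. primepow q \<and> (aprimedivisor q)\<^sup>2 \<le> N}"
  let ?B = "{q \<in> {1..N}. primepow q \<and> \<not> (aprimedivisor q)\<^sup>2 \<le> N}"
  have A: "real (card ?A) \<le> sqrt (real N) * real L"
  proof -
    have "?A \<subseteq> (\<lambda>(p, k). p ^ k) ` ({1..floor_sqrt N} \<times> {1..L})"
    proof
      fix q assume q: "q \<in> ?A"
      then obtain p k where p: "prime p" "k > 0" "q = p ^ k" by (auto simp: primepow_def)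
      have "p \<ge> 2" using p by (simp add: prime_ge_2_nat)
      have "p\<^sup>2 \<le> N" using q p by (auto simp: aprimedivisor_prime_power)
      then have "p \<in> {1..floor_sqrt N}" using \<open>p \<ge> 2\<close> by (auto simp: le_floor_sqrt_iff)
      moreover have "k \<le> L"
      proof -
        have "2 ^ k \<le> p ^ k" using \<open>p \<ge> 2\<close> by (intro power_mono) auto
        also have "p ^ k \<le> N" using p q by simp
        finally have "2 ^ k \<le> N" .
        from floor_log_le_iff[OF this] show ?thesis by (simp add: L_def)
      qed
      ultimately have "(p, k) \<in> {1..floor_sqrt N} \<times> {1..L}" using p(2) by simp
      then show "q \<in> (\<lambda>(p, k). p ^ k) ` ({1..floor_sqrt N} \<times> {1..L})"
        by (rule rev_image_eqI) (simp add: p(3))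
    qed
    then have "card ?A \<le> card ({1..floor_sqrt N} \<times> {1..L})" by (intro surj_card_le) auto
    also have "\<dots> = floor_sqrt N * L" by simp
    finally have "real (card ?A) \<le> real (floor_sqrt N * L)" by (rule of_nat_mono)
    then have "real (card ?A) \<le> real (floor_sqrt N) * real L" by simp
    also have "\<dots> \<le> sqrt (real N) * real L"
    proof (rule mult_right_mono)
      have "real ((floor_sqrt N)\<^sup>2) \<le> real N" by (rule of_nat_mono) simp
      then show "real (floor_sqrt N) \<le> sqrt (real N)" by (intro real_le_rsqrt) simp
    qed simp
    finally show ?thesis .
  qed
  have B: "real (card ?B) \<le> 8 * real N / l"
  proof -
    have "real (card ?B) * (l / 2) = (\<Sum>q\<in>?B. l / 2)" by simp
    also have "\<dots> \<le> (\<Sum>q\<in>?B. mangoldt q)"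
    proof (rule sum_mono)
      fix q assume q: "q \<in> ?B"
      let ?p = "aprimedivisor q"
      have p0: "?p > 0" using q by (intro Nat.gr0I) auto
      have "real N \<le> real (?p\<^sup>2)" using q by (intro of_nat_mono) auto
      then have "l \<le> ln (real (?p\<^sup>2))" unfolding l_def using N p0 by (subst ln_le_cancel_iff) auto
      also have "\<dots> = 2 * ln (real ?p)"
        using p0 by (simp add: ln_realpow)
      finally show "l / 2 \<le> mangoldt q" using q by (simp add: mangoldt_def)
    qed
    also have "\<dots> \<le> chebyshev_psi N"
      unfolding chebyshev_psi_def by (intro sum_mono2) (auto intro: mangoldt_nonneg)
    also have "\<dots> \<le> 4 * real N" by (rule chebyshev_psi_le)
    finally show ?thesis using lpos by (simp add: field_simps)
  qed
  \<comment> \<open>The quadratic term of the exponential series at \<open>l / 2\<close> turns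
    \<open>l\<^sup>2 / 8\<close> into \<open>sqrt N\<close>, and 9/2 = 36/8.\<close>
  have sq: "real L * (1 + real L) \<le> 36 * sqrt (real N)"
  proof -
    have "real L * (1 + real L) \<le> (3 * l / 2) * (3 * l)" using L1 L2 by (intro mult_mono) auto
    also have "\<dots> = 36 * ((l / 2)\<^sup>2 / 2)" by (simp add: power2_eq_square)
    also have "(l / 2)\<^sup>2 / 2 \<le> exp (l / 2)" using exp_lower_Taylor_quadratic[of "l / 2"] lpos by simp
    also have "exp (l / 2) = sqrt (real N)"
    proof -
      have "exp (l / 2) = real N powr (1/2)" using N by (simp add: powr_def l_def)
      then show ?thesis by (simp add: powr_half_sqrt)
    qed
    finally show ?thesis by simp
  qed
  have "{q \<in> {1..N}. primepow q} = ?A \<union> ?B" by auto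
  then have "real (primepow_count N) \<le> real (card ?A) + real (card ?B)"
    unfolding primepow_count_def using of_nat_mono[OF card_Un_le[of ?A ?B], where 'a = real] by simp
  also have "\<dots> \<le> sqrt (real N) * real L + 8 * real N / l" using A B by (rule add_mono)
  also have "\<dots> \<le> 36 * real N / (1 + real L) + 24 * real N / (1 + real L)"
  proof (rule add_mono)
    have "sqrt (real N) * (real L * (1 + real L)) \<le> sqrt (real N) * (36 * sqrt (real N))"
      using sq by (intro mult_left_mono) auto
    also have "\<dots> = 36 * (sqrt (real N) * sqrt (real N))" by (rule mult.left_commute)
    also have "\<dots> = 36 * real N" by simp
    finally show "sqrt (real N) * real L \<le> 36 * real N / (1 + real L)"
      by (simp add: pos_le_divide_eq mult_ac)
    have "8 * real N / l \<le> 8 * real N / ((1 + real L) / 3)"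
      using L2 lpos by (intro divide_left_mono) auto
    then show "8 * real N / l \<le> 24 * real N / (1 + real L)" by simp
  qed
  also have "\<dots> = 60 * real N / (1 + real L)" by (simp add: add_divide_distrib[symmetric])
  finally show ?thesis by (simp add: L_def)
qed

section \<open>The weighted sum\<close>

definition moebius_omega_harm :: "nat \<Rightarrow> real" where
  "moebius_omega_harm N = (\<Sum>n=1..N. of_int (moebius_mu n) * real (prime_omega n) / real n)"

text \<open>By Moebius inversion \<open>\<mu> \<omega>\<close> is the convolution of
  \<open>\<mu>\<close> with its own divisor sum \<open>w\<close>, which lives on prime powers. The
  weight \<open>1 / n\<close> factors along \<open>n = q * e\<close>, and the sum over
  \<open>e\<close> is \<open>moebius_harm (N div q)\<close>.\<close>

lemma moebius_omega_harm_conv: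
  "moebius_omega_harm N = - (\<Sum>q | q \<in> {1..N} \<and> primepow q. moebius_harm (N div q) / real q)"
proof -
  define w :: "nat \<Rightarrow> int" where "w q = (if primepow q then -1 else 0)" for q
  have "moebius_omega_harm N = (\<Sum>n=1..N. \<Sum>q | q dvd n. (of_int (w q) / real q) * (of_int (moebius_mu (n div q)) / real (n div q)))"
    unfolding moebius_omega_harm_def
  proof (intro sum.cong refl)
    fix n assume "n \<in> {1..N}"
    then have n: "n > 0" by simp
    have "moebius_mu n * int (prime_omega n) = (\<Sum>q | q dvd n. (\<Sum>d | d dvd q. moebius_mu d * int (prime_omega d)) * moebius_mu (n div q))"
      by (rule moebius_inversion[OF n, symmetric])
    also have "\<dots> = (\<Sum>q | q dvd n. w q * moebius_mu (n div q))"
    proof (intro sum.cong refl)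
      fix q assume "q \<in> {q. q dvd n}"
      then have "q > 0" using n by (auto intro: dvd_pos_nat)
      then show "(\<Sum>d | d dvd q. moebius_mu d * int (prime_omega d)) * moebius_mu (n div q) = w q * moebius_mu (n div q)"
        unfolding w_def by (subst sum_divisors_moebius_mu_omega) auto
    qed
    finally have "of_int (moebius_mu n * int (prime_omega n)) / real n
        = of_int (\<Sum>q | q dvd n. w q * moebius_mu (n div q)) / real n" by simp
    also have "\<dots> = (\<Sum>q | q dvd n. (of_int (w q) / real q) * (of_int (moebius_mu (n div q)) / real (n div q)))"
      unfolding of_int_sum sum_divide_distrib
    proof (intro sum.cong refl)
      fix q assume "q \<in> {q. q dvd n}"
      then have "real n = real q * real (n div q)" by (metis dvd_mult_div_cancel mem_Collect_eq of_nat_mult)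
      then show "of_int (w q * moebius_mu (n div q)) / real n
          = (of_int (w q) / real q) * (of_int (moebius_mu (n div q)) / real (n div q))" by simp
    qed
    finally show "of_int (moebius_mu n) * real (prime_omega n) / real n
        = (\<Sum>q | q dvd n. (of_int (w q) / real q) * (of_int (moebius_mu (n div q)) / real (n div q)))" by simp
  qed
  also have "\<dots> = (\<Sum>q=1..N. \<Sum>e=1..N div q. (of_int (w q) / real q) * (of_int (moebius_mu e) / real e))"
    by (rule sum_divisors_swap)
  also have "\<dots> = (\<Sum>q=1..N. of_int (w q) / real q * moebius_harm (N div q))"
    by (simp only: moebius_harm_def sum_distrib_left)
  also have "\<dots> = (\<Sum>q | q \<in> {1..N} \<and> primepow q. - (moebius_harm (N div q) / real q))"
    by (intro sum.mono_neutral_cong_right) (auto simp: w_def)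
  finally show ?thesis by (simp add: sum_negf)
qed

text \<open>\<open>N div n\<close> counts the multiples of \<open>n\<close> up to \<open>N\<close>,
  so the sum collects the divisor sums of \<open>\<mu> \<omega>\<close>, and each prime power
  contributes -1.\<close>

lemma sum_moebius_mu_omega_div:
  "(\<Sum>n=1..N. of_int (moebius_mu n) * real (prime_omega n) * real (N div n)) = - real (primepow_count N)"
proof -
  have "(\<Sum>n=1..N. moebius_mu n * int (prime_omega n) * int (N div n))
      = (\<Sum>n=1..N. \<Sum>e=1..N div n. moebius_mu n * int (prime_omega n))"
    by (simp add: mult.commute)
  also have "\<dots> = (\<Sum>n=1..N. \<Sum>d | d dvd n. moebius_mu d * int (prime_omega d))"
    by (rule sum_divisors_swap[symmetric])
  also have "\<dots> = (\<Sum>n=1..N. if primepow n then -1 else 0)"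
    by (intro sum.cong refl sum_divisors_moebius_mu_omega) auto
  also have "\<dots> = (\<Sum>n | n \<in> {1..N} \<and> primepow n. -1)"
    by (intro sum.mono_neutral_cong_right) auto
  also have "\<dots> = - int (primepow_count N)" by (simp add: primepow_count_def)
  finally have "real_of_int (\<Sum>n=1..N. moebius_mu n * int (prime_omega n) * int (N div n)) = of_int (- int (primepow_count N))"
    by (rule arg_cong)
  then show ?thesis by simp
qed

text \<open>This includes the case \<open>2 ^ j > N\<close>, where the quotient is 0,
  \<open>floor_log 0 = 0\<close> and the subtraction truncates.\<close>

lemma floor_log_div_power: "floor_log (N div 2 ^ j) = floor_log N - j"
proof (induction j)
  case (Suc j)
  have "N div 2 ^ Suc j = N div 2 ^ j div 2" by (simp only: power_Suc2 div_mult2_eq)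
  then show ?case using Suc by simp
qed simp

text \<open>Partial fractions: the two denominators add up to \<open>L + 2\<close> for every
  \<open>j\<close>, and both resulting sums are the same harmonic number.\<close>

lemma sum_inverse_product_le:
  "(\<Sum>j\<le>L. 1 / ((1 + real j) * (1 + real (L - j)))) \<le> 2 * (1 + ln (real (L + 1))) / (real L + 2)"
proof -
  have harm: "(\<Sum>j\<le>L. 1 / (1 + real j)) = harm (L + 1)"
    by (simp add: harm_def sum.atLeast1_atMost_eq divide_inverse add_ac flip: lessThan_Suc_atMost)
  have flip: "(\<Sum>j\<le>L. 1 / (1 + real (L - j))) = (\<Sum>j\<le>L. 1 / (1 + real j))"
    by (rule sum.reindex_bij_witness[where i = "\<lambda>j. L - j" and j = "\<lambda>j. L - j"]) auto
  have "(\<Sum>j\<le>L. 1 / ((1 + real j) * (1 + real (L - j))))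
      = (\<Sum>j\<le>L. (1 / (1 + real j) + 1 / (1 + real (L - j))) / (real L + 2))"
  proof (intro sum.cong refl)
    fix j assume "j \<in> {..L}"
    then have "real L = real j + real (L - j)" by simp
    then have L: "real L + 2 = (1 + real j) + (1 + real (L - j))" by linarith
    have pf: "1 / (a * b) = (1 / a + 1 / b) / (a + b)" if "a > 0" "b > 0" for a b :: real
    proof -
      have "1 / a + 1 / b = (a + b) / (a * b)" using that by (simp add: add_frac_eq add.commute)
      moreover have "a + b \<noteq> 0" using that by simp
      ultimately show ?thesis by simp
    qed
    show "1 / ((1 + real j) * (1 + real (L - j)))
        = (1 / (1 + real j) + 1 / (1 + real (L - j))) / (real L + 2)"
      unfolding L by (rule pf) auto
  qed
  also have "\<dots> = 2 * harm (L + 1) / (real L + 2)"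
    unfolding sum_divide_distrib[symmetric] sum.distrib flip harm by simp
  also have "\<dots> \<le> 2 * (1 + ln (real (L + 1))) / (real L + 2)"
  proof (intro divide_right_mono mult_left_mono)
    show "harm (L + 1) \<le> 1 + ln (real (L + 1))"
      using decseqD[OF decseq_harm_diff_ln, of 0 L] by (simp add: harm_expand)
  qed auto
  finally show ?thesis .
qed

text \<open>The prime powers \<open>q\<close> are sorted by \<open>j = floor_log (N div q)\<close>.
  In block \<open>j\<close> they are at most \<open>N div 2 ^ j\<close>, so
  \<open>primepow_count_le\<close> counts them, while \<open>moebius_harm (N div q)\<close> has
  order \<open>1 / (1 + j)\<close>.\<close>

lemma moebius_omega_harm_bound:
  obtains C where "C > 0"
    "\<And>N. N \<ge> 1 \<Longrightarrow> \<bar>moebius_omega_harm N\<bar> \<le> C * (1 + ln (real (floor_log N + 1))) / (real (floor_log N) + 2)"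
proof -
  obtain c where c: "c > 0" "\<And>N. N \<ge> 1 \<Longrightarrow> \<bar>moebius_harm N\<bar> \<le> c / (1 + ln (real N))"
    using moebius_harm_bound by blast
  \<comment> \<open>Restated with \<open>floor_log\<close>, which is constant on each block.\<close>
  have c': "\<bar>moebius_harm N\<bar> \<le> 2 * c / (1 + real (floor_log N))" if N: "N \<ge> 1" for N
  proof -
    have "real (floor_log N) * (1/2) \<le> real (floor_log N) * ln 2"
      using ln2_ge_two_thirds by (intro mult_left_mono) auto
    with floor_log_bounds(1)[OF N] have "(1 + real (floor_log N)) / 2 \<le> 1 + ln (real N)" by (simp add: field_simps)
    then have "c / (1 + ln (real N)) \<le> c / ((1 + real (floor_log N)) / 2)"
      using c(1) by (intro divide_left_mono mult_pos_pos) auto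
    with c(2)[OF N] show ?thesis by (simp add: mult.commute)
  qed
  show thesis
  proof (rule that)
    show "480 * c > 0" using c by simp
    fix N :: nat assume N: "N \<ge> 1"
    define L where "L = floor_log N"
    let ?Q = "{q. q \<in> {1..N} \<and> primepow q}"
    have "\<bar>moebius_omega_harm N\<bar> \<le> (\<Sum>q\<in>?Q. \<bar>moebius_harm (N div q) / real q\<bar>)"
      unfolding moebius_omega_harm_conv abs_minus_cancel by (rule sum_abs)
    also have "\<dots> = (\<Sum>j\<le>L. \<Sum>q\<in>{q \<in> ?Q. floor_log (N div q) = j}. \<bar>moebius_harm (N div q) / real q\<bar>)"
      by (rule sum.group[symmetric]) (auto simp: L_def intro!: floor_log_le_iff)
    also have "\<dots> \<le> (\<Sum>j\<le>L. 240 * c * (1 / ((1 + real j) * (1 + real (L - j)))))"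
    proof (rule sum_mono)
      fix j assume j: "j \<in> {..L}"
      let ?K = "{q \<in> ?Q. floor_log (N div q) = j}"
      have q: "q \<le> N div 2 ^ j" "1 / real q \<le> 2 * 2 ^ j / real N" "N div q \<ge> 1" if "q \<in> ?K" for q
      proof -
        have q0: "q > 0" using that by simp
        show q1: "N div q \<ge> 1" using that by (simp add: Suc_le_eq div_greater_zero_iff)
        then have "2 ^ j \<le> N div q" using floor_log_exp2_le[of "N div q"] that by auto
        then have "2 ^ j * q \<le> N" using q0 by (simp add: less_eq_div_iff_mult_less_eq)
        then show "q \<le> N div 2 ^ j" by (simp add: less_eq_div_iff_mult_less_eq mult.commute)
        have "N div q < 2 * 2 ^ j" using floor_log_exp2_gt[of "N div q"] that by auto
        then have "N < 2 * 2 ^ j * q" using q0 by (simp add: div_less_iff_less_mult)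
        then have "real N \<le> real (2 * 2 ^ j * q)" by (intro of_nat_mono) simp
        then show "1 / real q \<le> 2 * 2 ^ j / real N" using q0 N by (simp add: field_simps)
      qed
      have Nj: "N div 2 ^ j \<ge> 1"
      proof -
        have "2 ^ j \<le> (2::nat) ^ L" using j by (intro power_increasing) auto
        also have "\<dots> \<le> N" using floor_log_exp2_le[of N] N by (simp add: L_def)
        finally show ?thesis by (simp add: Suc_le_eq div_greater_zero_iff)
      qed
      have "(\<Sum>q\<in>?K. \<bar>moebius_harm (N div q) / real q\<bar>) \<le> (\<Sum>q\<in>?K. (2 * c / (1 + real j)) * (2 * 2 ^ j / real N))"
      proof (rule sum_mono)
        fix x assume x: "x \<in> ?K"
        have "\<bar>moebius_harm (N div x) / real x\<bar> = \<bar>moebius_harm (N div x)\<bar> * (1 / real x)" by simp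
        also have "\<dots> \<le> (2 * c / (1 + real j)) * (2 * 2 ^ j / real N)"
        proof (rule mult_mono)
          show "\<bar>moebius_harm (N div x)\<bar> \<le> 2 * c / (1 + real j)" using c'[OF q(3)[OF x]] x by auto
          show "1 / real x \<le> 2 * 2 ^ j / real N" by (rule q(2)[OF x])
        qed (use c in auto)
        finally show "\<bar>moebius_harm (N div x) / real x\<bar> \<le> (2 * c / (1 + real j)) * (2 * 2 ^ j / real N)" .
      qed
      also have "\<dots> = real (card ?K) * ((2 * c / (1 + real j)) * (2 * 2 ^ j / real N))" by simp
      \<comment> \<open>\<open>N / 2 ^ j\<close> from the count cancels \<open>2 ^ j / N\<close>
        from the weights, and 60 * 2 * 2 = 240.\<close>
      also have "\<dots> \<le> (60 * (real N / 2 ^ j) / (1 + real (L - j))) * ((2 * c / (1 + real j)) * (2 * 2 ^ j / real N))"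
      proof (rule mult_right_mono)
        have "card ?K \<le> primepow_count (N div 2 ^ j)"
          unfolding primepow_count_def using q(1) by (intro card_mono) auto
        then have "real (card ?K) \<le> real (primepow_count (N div 2 ^ j))" by (rule of_nat_mono)
        also have "\<dots> \<le> 60 * real (N div 2 ^ j) / (1 + real (floor_log (N div 2 ^ j)))"
          by (rule primepow_count_le[OF Nj])
        also have "\<dots> \<le> 60 * (real N / 2 ^ j) / (1 + real (L - j))"
          unfolding floor_log_div_power L_def
        proof (intro divide_right_mono mult_left_mono)
          have "real (N div 2 ^ j * 2 ^ j) \<le> real N" by (rule of_nat_mono) simp
          then show "real (N div 2 ^ j) \<le> real N / 2 ^ j" by (simp add: pos_le_divide_eq)
        qed auto
        finally show "real (card ?K) \<le> 60 * (real N / 2 ^ j) / (1 + real (L - j))" .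
      qed (use c in auto)
      also have "\<dots> = 240 * c * (1 / ((1 + real j) * (1 + real (L - j))))"
        using N by (simp add: divide_simps)
      finally show "(\<Sum>q\<in>?K. \<bar>moebius_harm (N div q) / real q\<bar>) \<le> 240 * c * (1 / ((1 + real j) * (1 + real (L - j))))" .
    qed
    also have "\<dots> = 240 * c * (\<Sum>j\<le>L. 1 / ((1 + real j) * (1 + real (L - j))))"
      by (rule sum_distrib_left[symmetric])
    also have "\<dots> \<le> 240 * c * (2 * (1 + ln (real (L + 1))) / (real L + 2))"
      using c by (intro mult_left_mono sum_inverse_product_le) auto
    also have "240 * c * (2 * X / Y) = 480 * c * X / Y" for X Y :: real by simp
    finally show "\<bar>moebius_omega_harm N\<bar> \<le> 480 * c * (1 + ln (real (floor_log N + 1))) / (real (floor_log N) + 2)"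
      by (simp add: L_def)
  qed
qed

section \<open>The sum with fractional parts\<close>

theorem theorem2:
  shows "(\<lambda>x::real. \<Sum>n | 1 \<le> n \<and> real n \<le> x.
            real_of_int (moebius_mu n) * real (prime_omega n) * frac (x / real n))
         \<in> O[at_top](\<lambda>x. x * sqrt (ln (ln x)) / sqrt (ln x))"
proof -
  let ?S = "\<lambda>x::real. \<Sum>n | 1 \<le> n \<and> real n \<le> x.
            real_of_int (moebius_mu n) * real (prime_omega n) * frac (x / real n)"
  obtain C where C: "C > 0"
    "\<And>N. N \<ge> 1 \<Longrightarrow> \<bar>moebius_omega_harm N\<bar> \<le> C * (1 + ln (real (floor_log N + 1))) / (real (floor_log N) + 2)"
    using moebius_omega_harm_bound by blast
  \<comment> \<open>The majorant reached below: \<open>3 / 2 * ln x\<close> bounds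
    \<open>floor_log N\<close> because \<open>ln 2 \<ge> 2/3\<close>, and the last summand bounds
    the number of prime powers.\<close>
  define B where "B x = x * (C * (1 + ln (3 / 2 * ln x + 1)) / ln x) + 60 * x / ln x" for x :: real
  have bound: "norm (?S x) \<le> norm (B x)" if x: "x \<ge> 2" for x
  proof -
    define N where "N = nat \<lfloor>x\<rfloor>"
    define L where "L = floor_log N"
    have N: "N \<ge> 1" "real N \<le> x" "x < real N + 1" using x by (auto simp: N_def le_nat_iff le_floor_iff)
    have lnx: "ln x > 0" using x by simp
    have set: "{n. 1 \<le> n \<and> real n \<le> x} = {1..N}" using x by (auto simp: N_def le_nat_floor le_nat_iff le_floor_iff)
    \<comment> \<open>The floor of \<open>x / n\<close> depends only on the floor of
      \<open>x\<close>, so \<open>sum_moebius_mu_omega_div\<close> applies to the floor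
      part.\<close>
    have fr: "frac (x / real n) = x / real n - real (N div n)" if "n \<ge> 1" for n
    proof -
      have "\<lfloor>x / real n\<rfloor> = \<lfloor>x\<rfloor> div int n" using floor_divide_real_eq_div[of "int n" x] by simp
      also have "\<dots> = int (N div n)" using x by (simp add: N_def zdiv_int)
      finally show ?thesis by (simp add: frac_def)
    qed
    have "?S x = (\<Sum>n=1..N. x * (of_int (moebius_mu n) * real (prime_omega n) / real n)
        - of_int (moebius_mu n) * real (prime_omega n) * real (N div n))"
      unfolding set by (intro sum.cong refl) (simp add: fr algebra_simps)
    also have "\<dots> = x * moebius_omega_harm N + real (primepow_count N)"
      unfolding sum_subtractf sum_moebius_mu_omega_div moebius_omega_harm_def by (simp add: sum_distrib_left)
    finally have eq: "?S x = x * moebius_omega_harm N + real (primepow_count N)" .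
    \<comment> \<open>Since \<open>x\<close> may exceed \<open>N\<close>, the comparison goes
      through \<open>x < N + 1 \<le> 2 ^ Suc L\<close>.\<close>
    have L1: "ln x \<le> 1 + real L"
    proof -
      have "N < 2 ^ Suc L" using floor_log_exp2_gt[of N] by (simp add: L_def)
      then have "N + 1 \<le> 2 ^ Suc L" by simp
      then have "real (N + 1) \<le> real (2 ^ Suc L)" by (rule of_nat_mono)
      with N have "x \<le> 2 ^ Suc L" by simp
      then have "ln x \<le> ln (2 ^ Suc L)" using x by (subst ln_le_cancel_iff) auto
      also have "\<dots> = real (Suc L) * ln 2" by (rule ln_realpow)
      also have "\<dots> \<le> real (Suc L) * 1" using ln_2_less_1 by (intro mult_left_mono) auto
      finally show ?thesis by simp
    qed
    have L2: "real L \<le> 3 / 2 * ln x"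
    proof -
      have "real L * (2/3) \<le> real L * ln 2" using ln2_ge_two_thirds by (intro mult_left_mono) auto
      also have "\<dots> \<le> ln (real N)" unfolding L_def by (rule floor_log_bounds(1)[OF N(1)])
      also have "\<dots> \<le> ln x" using N x by (subst ln_le_cancel_iff) auto
      finally show ?thesis by simp
    qed
    have "\<bar>moebius_omega_harm N\<bar> \<le> C * (1 + ln (real (L + 1))) / (real L + 2)"
      unfolding L_def by (rule C(2)[OF N(1)])
    also have "\<dots> \<le> C * (1 + ln (3 / 2 * ln x + 1)) / ln x"
      using L1 L2 lnx C(1) by (intro frac_le mult_left_mono) auto
    finally have 1: "\<bar>moebius_omega_harm N\<bar> \<le> C * (1 + ln (3 / 2 * ln x + 1)) / ln x" .
    have "real (primepow_count N) \<le> 60 * real N / (1 + real L)"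
      unfolding L_def by (rule primepow_count_le[OF N(1)])
    also have "\<dots> \<le> 60 * x / ln x" using L1 N lnx x by (intro frac_le) auto
    finally have 2: "real (primepow_count N) \<le> 60 * x / ln x" .
    have "\<bar>?S x\<bar> \<le> x * \<bar>moebius_omega_harm N\<bar> + real (primepow_count N)"
      unfolding eq using x by (intro order_trans[OF abs_triangle_ineq]) (simp add: abs_mult)
    also have "\<dots> \<le> B x" unfolding B_def using 1 2 x by (intro add_mono mult_left_mono) auto
    finally show ?thesis by simp
  qed
  have "?S \<in> O[at_top](B)"
    by (rule landau_o.big_mono, rule eventually_mono[OF eventually_ge_at_top[of 2]], rule bound)
  \<comment> \<open>The main term has order \<open>x * u\<close> with
    \<open>u = ln (ln x) / ln x\<close>, and \<open>u \<le> sqrt u\<close> once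
    \<open>0 \<le> u \<le> 1\<close>.\<close>
  also have "B \<in> O[at_top](\<lambda>x. x * sqrt (ln (ln x)) / sqrt (ln x))"
    unfolding B_def using C(1) by real_asymp
  finally show ?thesis .
qed

end
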